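(* Let $f:M\to\mathbb{H}^3$ be a surface of constant Gaussian curvature $K>-1$, and let $\mathrm{d}s^2=e^u\,\mathrm{d}z\mathrm{d}\bar z$ be the metric on $M$ defined by the function $e^u$ in the expressions $$\mathrm{I}=Q\,\mathrm{d}z^2+(e^u+|Q|^2e^{-u})\,\mathrm{d}z\mathrm{d}\bar z+\bar Q\,\mathrm{d}\bar z^2,\qquad \mathrm{I\!I}=\sigma(e^u-|Q|^2e^{-u})\,\mathrm{d}z\mathrm{d}\bar z$$ of the first and second fundamental forms of $f$. Then $f$ is a weakly complete surface if and only if the metric $\mathrm{d}s^2$ is complete.
   Context: Ambient space: $\mathbb{E}^{1,3}=\mathbb{R}^4$ with $\langle\cdot,\cdot\rangle=-\mathrm{d}x_0^2+\mathrm{d}x_1^2+\mathrm{d}x_2^2+\mathrm{d}x_3^2$ and $\mathbb{H}^3=\{x:\langle x,x\rangle=-1,\ x_0>0\}$. A surface $f:M\to\mathbb{H}^3$ is a smooth immersion of a connected 2-manifold with unit normal $n:M\to\mathbb{E}^{1,3}$ ($\langle n,n\rangle=1$, $\langle n,f\rangle=0$, $\langle n,\mathrm{d}f\rangle=0$). $\mathrm{I}=\langle \mathrm{d}f,\mathrm{d}f\rangle$, $\mathrm{I\!I}=-\langle \mathrm{d}f,\mathrm{d}n\rangle$, and $K=-1+\det(\mathrm{I}^{-1}\mathrm{I\!I})$. When $K>-1$, $n$ is chosen so that $\mathrm{I\!I}$ is positive definite, $\sigma>0$ is defined by $K=-1+\sigma^2$, and $z=x+iy$ denotes local conformal coordinates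 for $\mathrm{I\!I}$ (orientation of $M$ determined by $n$). Then $Q=\langle\partial f,\partial f\rangle$ (complex bilinear extension, $\partial=\frac12(\partial_x-i\partial_y)$), and there is a unique real function $u$ with $e^{2u}>|Q|^2$ such that the two displayed expressions hold; equivalently $2e^u\,\mathrm{d}z\mathrm{d}\bar z=\mathrm{I}^{(1,1)}+\sigma^{-1}\mathrm{I\!I}$, where $\mathrm{I}^{(1,1)}$ is the $\mathrm{d}z\mathrm{d}\bar z$-part of $\mathrm{I}$, so $e^u\,\mathrm{d}z\mathrm{d}\bar z$ is a globally defined Riemannian metric on $M$. The weak metric of $f$ is $\mathrm{d}t^2=\langle \mathrm{d}f,\mathrm{d}f\rangle+\frac{1}{1+K}\langle \mathrm{d}n,\mathrm{d}n\rangle$; $f$ is weakly complete if $\mathrm{d}t^2$ is complete. *)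

theory Defs
  imports "HOL-Analysis.Analysis"
begin

section \<open>Smooth 2-manifolds\<close>

text \<open>
  Continuous differentiability of all orders, for maps on an open subset of a Euclidean space:
  the second argument is the order.
\<close>

primrec Ck_on :: "'b::euclidean_space set \<Rightarrow> nat \<Rightarrow> ('b \<Rightarrow> 'c::real_normed_vector) \<Rightarrow> bool" where
  "Ck_on S 0 = (\<lambda>h. continuous_on S h)"
| "Ck_on S (Suc k) = (\<lambda>h. (\<forall>x\<in>S. h differentiable (at x)) \<and>
      (\<forall>v. Ck_on S k (\<lambda>x. frechet_derivative h (at x) v)))"

definition smooth_on :: "'b::euclidean_space set \<Rightarrow> ('b \<Rightarrow> 'c::real_normed_vector) \<Rightarrow> bool" where
  "smooth_on S h \<longleftrightarrow> (\<forall>k. Ck_on S k h)"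

text \<open>
  A chart is a domain together with a coordinate map into the plane. The plane is the type
  \<^typ>\<open>complex\<close>, used here as a real vector space with basis \<^term>\<open>1\<close>, \<^term>\<open>\<i>\<close>, so that a chart
  is directly a coordinate \<open>z = x + i y\<close>. All derivatives below are real (Frechet) derivatives.
\<close>

type_synonym 'a chart = "'a set \<times> ('a \<Rightarrow> complex)"

definition chart_inv :: "'a chart \<Rightarrow> complex \<Rightarrow> 'a" where
  "chart_inv c = inv_into (fst c) (snd c)"

definition is_chart :: "'a topology \<Rightarrow> 'a chart \<Rightarrow> bool" where
  "is_chart M c \<longleftrightarrow> openin M (fst c) \<and> open (snd c ` fst c) \<and>
     homeomorphic_map (subtopology M (fst c)) (top_of_set (snd c ` fst c)) (snd c)"

definition smooth_transition :: "'a chart \<Rightarrow> 'a chart \<Rightarrow> bool" where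
  "smooth_transition c d \<longleftrightarrow> smooth_on (snd c ` (fst c \<inter> fst d)) (snd d \<circ> chart_inv c)"

definition smooth_compatible :: "'a chart \<Rightarrow> 'a chart \<Rightarrow> bool" where
  "smooth_compatible c d \<longleftrightarrow> smooth_transition c d \<and> smooth_transition d c"

text \<open>\<open>A\<close> is the maximal atlas.\<close>

definition smooth_surface :: "'a topology \<Rightarrow> 'a chart set \<Rightarrow> bool" where
  "smooth_surface M A \<longleftrightarrow>
     Hausdorff_space M \<and> second_countable M \<and>
     (\<forall>c\<in>A. is_chart M c) \<and> (\<Union>c\<in>A. fst c) = topspace M \<and>
     (\<forall>c\<in>A. \<forall>d\<in>A. smooth_compatible c d) \<and>
     (\<forall>c. is_chart M c \<longrightarrow> (\<forall>d\<in>A. smooth_compatible c d) \<longrightarrow> c \<in> A)"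

definition charts_at :: "'a chart set \<Rightarrow> 'a \<Rightarrow> 'a chart set" where
  "charts_at A p = {c \<in> A. p \<in> fst c}"

definition smooth_map :: "'a chart set \<Rightarrow> ('a \<Rightarrow> 'b::euclidean_space) \<Rightarrow> bool" where
  "smooth_map A h \<longleftrightarrow> (\<forall>c\<in>A. smooth_on (snd c ` fst c) (h \<circ> chart_inv c))"

text \<open>
  A tangent vector at \<open>p\<close> is the family of its components with respect to all charts around \<open>p\<close>,
  related by the derivatives of the transition maps. Charts not containing \<open>p\<close> get the value
  \<open>0\<close>, so that a tangent vector is determined by its components in one chart around \<open>p\<close>.
\<close>

type_synonym 'a tangent = "'a chart \<Rightarrow> complex"

definition tangent_space :: "'a chart set \<Rightarrow> 'a \<Rightarrow> 'a tangent set" where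
  "tangent_space A p = {X.
     (\<forall>c\<in>charts_at A p. \<forall>d\<in>charts_at A p.
        X d = frechet_derivative (snd d \<circ> chart_inv c) (at (snd c p)) (X c)) \<and>
     (\<forall>c. c \<notin> charts_at A p \<longrightarrow> X c = 0)}"

text \<open>
  The tangent vector at \<open>p\<close> with component \<open>v\<close> in the chart \<open>c\<close>; thus \<open>v = 1\<close> gives
  \<open>\<partial>\<^sub>x\<close> and \<open>v = \<i>\<close> gives \<open>\<partial>\<^sub>y\<close>.
\<close>

definition coord_vector :: "'a chart set \<Rightarrow> 'a chart \<Rightarrow> 'a \<Rightarrow> complex \<Rightarrow> 'a tangent" where
  "coord_vector A c p v = (\<lambda>d. if d \<in> charts_at A p
     then frechet_derivative (snd d \<circ> chart_inv c) (at (snd c p)) v else 0)"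

text \<open>
  The differential of a smooth map. By the chain rule the value on a tangent vector does not
  depend on the chart around \<open>p\<close>.
\<close>

definition differential ::
    "'a chart set \<Rightarrow> ('a \<Rightarrow> 'b::euclidean_space) \<Rightarrow> 'a \<Rightarrow> 'a tangent \<Rightarrow> 'b" where
  "differential A h p X = (let c = (SOME c. c \<in> charts_at A p) in
     frechet_derivative (h \<circ> chart_inv c) (at (snd c p)) (X c))"


section \<open>Completeness of metrics on a surface\<close>

type_synonym 'a form = "'a \<Rightarrow> 'a tangent \<Rightarrow> 'a tangent \<Rightarrow> real"

text \<open>
  \<open>\<gamma>\<close> is continuously differentiable on the interval \<open>J\<close>, with one-sided derivatives at
  the end points: in every chart, on the part of \<open>J\<close> that \<open>\<gamma>\<close> maps into its domain.
\<close>

definition C1_curve_on :: "'a chart set \<Rightarrow> (real \<Rightarrow> 'a) \<Rightarrow> real set \<Rightarrow> bool" where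
  "C1_curve_on A \<gamma> J \<longleftrightarrow> (\<forall>c\<in>A. let T = {t \<in> J. \<gamma> t \<in> fst c} in
     \<exists>D. continuous_on T D \<and> (\<forall>t\<in>T. ((snd c \<circ> \<gamma>) has_vector_derivative D t) (at t within T)))"

definition piecewise_C1_path :: "'a topology \<Rightarrow> 'a chart set \<Rightarrow> (real \<Rightarrow> 'a) \<Rightarrow> bool" where
  "piecewise_C1_path M A \<gamma> \<longleftrightarrow> pathin M \<gamma> \<and>
     (\<exists>S. finite S \<and> (\<forall>a b. 0 \<le> a \<and> a < b \<and> b \<le> 1 \<and> {a<..<b} \<inter> S = {}
        \<longrightarrow> C1_curve_on A \<gamma> {a..b}))"

text \<open>
  At the finitely many break points the value is irrelevant, as it only enters under an integral.
\<close>

definition velocity :: "'a chart set \<Rightarrow> (real \<Rightarrow> 'a) \<Rightarrow> real \<Rightarrow> 'a tangent" where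
  "velocity A \<gamma> t = (\<lambda>c. if c \<in> charts_at A (\<gamma> t)
     then vector_derivative (snd c \<circ> \<gamma>) (at t within {0..1}) else 0)"

definition curve_length :: "'a chart set \<Rightarrow> 'a form \<Rightarrow> (real \<Rightarrow> 'a) \<Rightarrow> real" where
  "curve_length A g \<gamma> =
     integral {0..1} (\<lambda>t. sqrt (g (\<gamma> t) (velocity A \<gamma> t) (velocity A \<gamma> t)))"

text \<open>
  The value \<open>0\<close> outside the surface only serves the axioms of \<^locale>\<open>Metric_space\<close>, which
  require non-negativity and symmetry on the whole type.
\<close>

definition riemannian_dist :: "'a topology \<Rightarrow> 'a chart set \<Rightarrow> 'a form \<Rightarrow> 'a \<Rightarrow> 'a \<Rightarrow> real" where
  "riemannian_dist M A g p q = (if p \<in> topspace M \<and> q \<in> topspace M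
     then Inf {curve_length A g \<gamma> | \<gamma>. piecewise_C1_path M A \<gamma> \<and> \<gamma> 0 = p \<and> \<gamma> 1 = q} else 0)"

definition complete_metric :: "'a topology \<Rightarrow> 'a chart set \<Rightarrow> 'a form \<Rightarrow> bool" where
  "complete_metric M A g \<longleftrightarrow> Metric_space.mcomplete (topspace M) (riemannian_dist M A g)"


section \<open>Surfaces in hyperbolic space\<close>

text \<open>
  The coordinates \<open>x\<^sub>0, x\<^sub>1, x\<^sub>2, x\<^sub>3\<close> are indexed by the type \<^typ>\<open>4\<close>, whose elements are
  \<open>0, 1, 2, 3\<close>. On \<^typ>\<open>complex^4\<close> this is the complex bilinear extension.
\<close>

definition minkowski :: "'k::comm_ring_1^4 \<Rightarrow> 'k^4 \<Rightarrow> 'k" where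
  "minkowski x y = - (x $ 0 * y $ 0) + x $ 1 * y $ 1 + x $ 2 * y $ 2 + x $ 3 * y $ 3"

definition hyperbolic_space :: "(real^4) set" where
  "hyperbolic_space = {x. minkowski x x = -1 \<and> x $ 0 > 0}"

definition hyperbolic_surface ::
    "'a topology \<Rightarrow> 'a chart set \<Rightarrow> ('a \<Rightarrow> real^4) \<Rightarrow> ('a \<Rightarrow> real^4) \<Rightarrow> bool" where
  "hyperbolic_surface M A f n \<longleftrightarrow>
     smooth_surface M A \<and> connected_space M \<and>
     f ` topspace M \<subseteq> hyperbolic_space \<and> smooth_map A f \<and>
     (\<forall>p\<in>topspace M. inj_on (differential A f p) (tangent_space A p)) \<and>
     smooth_map A n \<and>
     (\<forall>p\<in>topspace M. minkowski (n p) (n p) = 1 \<and> minkowski (n p) (f p) = 0 \<and>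
        (\<forall>X\<in>tangent_space A p. minkowski (n p) (differential A f p X) = 0))"

definition fundI :: "'a chart set \<Rightarrow> ('a \<Rightarrow> real^4) \<Rightarrow> 'a form" where
  "fundI A f p X Y = minkowski (differential A f p X) (differential A f p Y)"

definition fundII :: "'a chart set \<Rightarrow> ('a \<Rightarrow> real^4) \<Rightarrow> ('a \<Rightarrow> real^4) \<Rightarrow> 'a form" where
  "fundII A f n p X Y = - minkowski (differential A f p X) (differential A n p Y)"

text \<open>The matrix of a bilinear form with respect to \<open>\<partial>\<^sub>x\<close>, \<open>\<partial>\<^sub>y\<close>.\<close>

definition form_matrix :: "'a chart set \<Rightarrow> 'a chart \<Rightarrow> 'a form \<Rightarrow> 'a \<Rightarrow> real^2^2" where
  "form_matrix A c g p = (let e = (\<lambda>i::2. coord_vector A c p (if i = 1 then 1 else \<i>)) in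
     (\<chi> i j. g p (e i) (e j)))"

definition gauss_curvature ::
    "'a chart set \<Rightarrow> ('a \<Rightarrow> real^4) \<Rightarrow> ('a \<Rightarrow> real^4) \<Rightarrow> 'a \<Rightarrow> real" where
  "gauss_curvature A f n p = (let c = (SOME c. c \<in> charts_at A p) in
     -1 + det (matrix_inv (form_matrix A c (fundI A f) p) ** form_matrix A c (fundII A f n) p))"

definition positive_definite_on :: "'a topology \<Rightarrow> 'a chart set \<Rightarrow> 'a form \<Rightarrow> bool" where
  "positive_definite_on M A g \<longleftrightarrow>
     (\<forall>p\<in>topspace M. \<forall>X\<in>tangent_space A p. X \<noteq> (\<lambda>_. 0) \<longrightarrow> g p X X > 0)"

definition weak_metric :: "'a chart set \<Rightarrow> ('a \<Rightarrow> real^4) \<Rightarrow> ('a \<Rightarrow> real^4) \<Rightarrow> 'a form" where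
  "weak_metric A f n p X Y = minkowski (differential A f p X) (differential A f p Y) +
     1 / (1 + gauss_curvature A f n p) * minkowski (differential A n p X) (differential A n p Y)"

definition weakly_complete ::
    "'a topology \<Rightarrow> 'a chart set \<Rightarrow> ('a \<Rightarrow> real^4) \<Rightarrow> ('a \<Rightarrow> real^4) \<Rightarrow> bool" where
  "weakly_complete M A f n \<longleftrightarrow> complete_metric M A (weak_metric A f n)"


section \<open>Conformal coordinates for the second fundamental form\<close>

text \<open>The forms \<open>dz\<^sup>2\<close> and \<open>dz d\<bar>z = dx\<^sup>2 + dy\<^sup>2\<close> as symmetric bilinear forms.\<close>

definition dz2 :: "'a chart \<Rightarrow> 'a tangent \<Rightarrow> 'a tangent \<Rightarrow> complex" where
  "dz2 c X Y = X c * Y c"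

definition dzdzbar :: "'a chart \<Rightarrow> 'a tangent \<Rightarrow> 'a tangent \<Rightarrow> real" where
  "dzdzbar c X Y = Re (X c * cnj (Y c))"

text \<open>
  The orientation determined by \<open>n\<close>: \<open>(\<partial>\<^sub>x f, \<partial>\<^sub>y f, n)\<close> is a positive basis of the tangent
  space of hyperbolic space, that is, \<open>(f, \<partial>\<^sub>x f, \<partial>\<^sub>y f, n)\<close> is a positive basis of
  \<^typ>\<open>real^4\<close>. The rows are indexed explicitly because \<^const>\<open>vector\<close> would start with the
  index \<open>1\<close>, which changes the sign.
\<close>

definition positively_oriented ::
    "'a chart set \<Rightarrow> ('a \<Rightarrow> real^4) \<Rightarrow> ('a \<Rightarrow> real^4) \<Rightarrow> 'a chart \<Rightarrow> bool" where
  "positively_oriented A f n c \<longleftrightarrow> (\<forall>p\<in>fst c.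
     det ((\<chi> i. if i = 0 then f p
                else if i = 1 then differential A f p (coord_vector A c p 1)
                else if i = 2 then differential A f p (coord_vector A c p \<i>)
                else n p) :: real^4^4) > 0)"

definition conformal_coordinate ::
    "'a chart set \<Rightarrow> ('a \<Rightarrow> real^4) \<Rightarrow> ('a \<Rightarrow> real^4) \<Rightarrow> 'a chart \<Rightarrow> bool" where
  "conformal_coordinate A f n c \<longleftrightarrow> c \<in> A \<and> positively_oriented A f n c \<and>
     (\<forall>p\<in>fst c. \<exists>l>0. \<forall>X\<in>tangent_space A p. \<forall>Y\<in>tangent_space A p.
        fundII A f n p X Y = l * dzdzbar c X Y)"

text \<open>\<open>\<partial>f = (\<partial>\<^sub>x f - i \<partial>\<^sub>y f) / 2\<close>\<close>

definition del_z :: "'a chart set \<Rightarrow> ('a \<Rightarrow> real^4) \<Rightarrow> 'a chart \<Rightarrow> 'a \<Rightarrow> complex^4" where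
  "del_z A f c p = (\<chi> i.
     (of_real (differential A f p (coord_vector A c p 1) $ i)
       - \<i> * of_real (differential A f p (coord_vector A c p \<i>) $ i)) / 2)"

definition hopf_coeff :: "'a chart set \<Rightarrow> ('a \<Rightarrow> real^4) \<Rightarrow> 'a chart \<Rightarrow> 'a \<Rightarrow> complex" where
  "hopf_coeff A f c p = minkowski (del_z A f c p) (del_z A f c p)"

text \<open>
  The function \<open>u\<close> on the domain of \<open>c\<close> satisfies, with \<open>Q = \<langle>\<partial>f, \<partial>f\<rangle>\<close> and \<open>e\<^sup>2\<^sup>u > |Q|\<^sup>2\<close>, both
  \<open>I = Q dz\<^sup>2 + (e\<^sup>u + |Q|\<^sup>2 e\<^sup>-\<^sup>u) dz d\<bar>z + \<bar>Q d\<bar>z\<^sup>2\<close> and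
  \<open>II = \<sigma> (e\<^sup>u - |Q|\<^sup>2 e\<^sup>-\<^sup>u) dz d\<bar>z\<close>.
\<close>

definition fundamental_expressions ::
    "'a chart set \<Rightarrow> ('a \<Rightarrow> real^4) \<Rightarrow> ('a \<Rightarrow> real^4) \<Rightarrow> real \<Rightarrow> 'a chart \<Rightarrow> ('a \<Rightarrow> real) \<Rightarrow> bool"
where
  "fundamental_expressions A f n \<sigma> c u \<longleftrightarrow> (\<forall>p\<in>fst c. let Q = hopf_coeff A f c p in
     exp (2 * u p) > (cmod Q)\<^sup>2 \<and>
     (\<forall>X\<in>tangent_space A p. \<forall>Y\<in>tangent_space A p.
        complex_of_real (fundI A f p X Y) =
          Q * dz2 c X Y
          + of_real ((exp (u p) + (cmod Q)\<^sup>2 * exp (- u p)) * dzdzbar c X Y)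
          + cnj Q * cnj (dz2 c X Y) \<and>
        fundII A f n p X Y =
          \<sigma> * (exp (u p) - (cmod Q)\<^sup>2 * exp (- u p)) * dzdzbar c X Y))"

text \<open>
  \<open>g\<close> is the metric given by \<open>e\<^sup>u dz d\<bar>z\<close> in local conformal coordinates. It is enough to ask for
  one such coordinate around each point, since \<open>e\<^sup>u dz d\<bar>z\<close> is independent of the choice.
\<close>

definition eu_metric ::
    "'a topology \<Rightarrow> 'a chart set \<Rightarrow> ('a \<Rightarrow> real^4) \<Rightarrow> ('a \<Rightarrow> real^4) \<Rightarrow> real \<Rightarrow> 'a form \<Rightarrow> bool" where
  "eu_metric M A f n \<sigma> g \<longleftrightarrow> (\<forall>p\<in>topspace M. \<exists>c u.
     p \<in> fst c \<and> conformal_coordinate A f n c \<and> fundamental_expressions A f n \<sigma> c u \<and>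
     (\<forall>q\<in>fst c. \<forall>X\<in>tangent_space A q. \<forall>Y\<in>tangent_space A q.
        g q X Y = exp (u q) * dzdzbar c X Y))"

end

theory Submission
  imports Defs
begin

text \<open>
  In a conformal coordinate for \<open>II\<close> write \<open>w = e\<^sup>u + |Q|\<^sup>2 e\<^sup>-\<^sup>u\<close> and
  \<open>d = e\<^sup>u - |Q|\<^sup>2 e\<^sup>-\<^sup>u > 0\<close>. Then \<open>tr I = 2w\<close>, \<open>det I = d\<^sup>2\<close> and \<open>II = \<sigma> d id\<close>, so
  \<open>III = II I\<^sup>-\<^sup>1 II = \<sigma>\<^sup>2 adj I\<close> and the weak metric is
  \<open>I + adj I = 2w dz d\<bar>z\<close>. Since \<open>|Q|\<^sup>2 e\<^sup>-\<^sup>u < e\<^sup>u\<close>, it lies between \<open>2 ds\<^sup>2\<close> and \<open>4 ds\<^sup>2\<close>,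
  and bi-Lipschitz metrics are complete simultaneously.

  As \<open>u\<close> is not known to be continuous, continuity of \<open>ds\<^sup>2\<close> (hence integrability of the speed of a curve)
  comes from \<open>4 ds\<^sup>2 = dt\<^sup>2 + 2 \<sigma>\<^sup>-\<^sup>1 II\<close>. Comparing completeness needs that the
  Riemannian distances satisfy the axioms of a metric space, which is where connectedness and the
  Hausdorff property of \<open>M\<close> enter.
\<close>

section \<open>Charts and smooth maps\<close>

text \<open>Lengths are defined by \<open>integral\<close>, which is 0 on a non-integrable function,
  so a pointwise inequality between two metrics says nothing about lengths until both speeds are
  known to be integrable. Hence continuity is settled for dt^2 and for ds^2 separately, before
  lengths are compared.

  A length depends on the metric only through its quadratic form. The theory of curves is therefore
  developed for an arbitrary function of point and vector that is continuous, positive and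
  homogeneous of degree 2 in each chart. The geometry of hyperbolic space is confined to a
  computation at a single point p, in which u(p) and Q(p) are mere numbers.

  That computation solves for the coefficients of dn in the frame formed by f, the two coordinate
  derivatives of f, and n. The orientation condition makes this a basis of R^4, and dn turns out to
  be tangential. The factor 1/(1+K) = 1/\<sigma>^2 of the weak metric is exactly what cancels the
  \<sigma>^2 in III.\<close>

lemma smooth_on_differentiable:
  assumes "smooth_on S h" "x \<in> S"
  shows "h differentiable (at x)"
proof -
  have "Ck_on S (Suc 0) h" using assms(1) unfolding smooth_on_def by blast
  then show ?thesis using assms(2) by simp
qed

lemma smooth_on_continuous_derivative:
  assumes "smooth_on S h"
  shows "continuous_on S (\<lambda>x. frechet_derivative h (at x) v)"
proof -
  have "Ck_on S (Suc 0) h" using assms unfolding smooth_on_def by blast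
  then show ?thesis by simp
qed

lemma linear_complex_expand:
  assumes "linear (L :: complex \<Rightarrow> 'b::real_vector)"
  shows "L v = Re v *\<^sub>R L 1 + Im v *\<^sub>R L \<i>"
proof -
  have "v = Re v *\<^sub>R 1 + Im v *\<^sub>R \<i>"
    by (simp add: complex_eq_iff)
  then have "L v = L (Re v *\<^sub>R 1 + Im v *\<^sub>R \<i>)" by simp
  then show ?thesis
    by (simp only: linear_add[OF assms] linear_scale[OF assms])
qed

text \<open>Smoothness gives continuity of the derivative for each fixed direction only. The speed
  of a curve evaluates it at a moving point and a moving vector; linearity in \<open>v\<close> and
  the basis 1, i of the plane reduce this to two fixed directions.\<close>

lemma smooth_on_continuous_derivative_joint:
  fixes h :: "complex \<Rightarrow> 'b::real_normed_vector"
  assumes "smooth_on S h"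
  shows "continuous_on (S \<times> UNIV) (\<lambda>(z, v). frechet_derivative h (at z) v)"
proof -
  note c = smooth_on_continuous_derivative[OF assms]
  have "continuous_on (S \<times> (UNIV :: complex set))
      (\<lambda>x. Re (snd x) *\<^sub>R frechet_derivative h (at (fst x)) 1
         + Im (snd x) *\<^sub>R frechet_derivative h (at (fst x)) \<i>)"
    by (intro continuous_intros continuous_on_compose2[OF c]) auto
  moreover have "frechet_derivative h (at z) v
      = Re v *\<^sub>R frechet_derivative h (at z) 1 + Im v *\<^sub>R frechet_derivative h (at z) \<i>"
    if "z \<in> S" for z v
    by (rule linear_complex_expand[OF linear_frechet_derivative])
       (use smooth_on_differentiable[OF assms that] in simp)
  ultimately show ?thesis
    unfolding case_prod_unfold
    by (elim continuous_on_eq) (metis mem_Times_iff)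
qed

lemma frechet_derivative_has_derivative:
  assumes "smooth_on S h" "x \<in> S"
  shows "(h has_derivative frechet_derivative h (at x)) (at x)"
  using smooth_on_differentiable[OF assms] frechet_derivative_works by blast

section \<open>Charts as homeomorphisms onto open subsets of the plane\<close>

locale surface =
  fixes M :: "'a topology" and A :: "'a chart set"
  assumes surface: "smooth_surface M A"
begin

lemma Hausdorff: "Hausdorff_space M"
  using surface by (simp add: smooth_surface_def)

lemma chart: "c \<in> A \<Longrightarrow> is_chart M c"
  using surface by (simp add: smooth_surface_def)

lemma chart_exists: "p \<in> topspace M \<Longrightarrow> \<exists>c. c \<in> charts_at A p"
  using surface unfolding smooth_surface_def charts_at_def by blast

lemma chart_openin: "c \<in> A \<Longrightarrow> openin M (fst c)"
  using chart by (auto simp: is_chart_def)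

lemma chart_subset: "c \<in> A \<Longrightarrow> fst c \<subseteq> topspace M"
  using chart_openin openin_subset by blast

lemma chart_open: "c \<in> A \<Longrightarrow> open (snd c ` fst c)"
  using chart by (auto simp: is_chart_def)

lemma chart_homeomorphic:
  "c \<in> A \<Longrightarrow> homeomorphic_map (subtopology M (fst c)) (top_of_set (snd c ` fst c)) (snd c)"
  using chart by (auto simp: is_chart_def)

lemma chart_inj: "c \<in> A \<Longrightarrow> inj_on (snd c) (fst c)"
  using chart_homeomorphic[of c] chart_subset[of c]
  by (auto simp: homeomorphic_eq_everything_map Int_absorb1)

lemma chart_inv_left [simp]: "c \<in> A \<Longrightarrow> p \<in> fst c \<Longrightarrow> chart_inv c (snd c p) = p"
  unfolding chart_inv_def using chart_inj by simp

lemma chart_inv_right: "z \<in> snd c ` fst c \<Longrightarrow> snd c (chart_inv c z) = z"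
  unfolding chart_inv_def by (rule f_inv_into_f)

lemma chart_inv_in: "z \<in> snd c ` fst c \<Longrightarrow> chart_inv c z \<in> fst c"
  unfolding chart_inv_def by (rule inv_into_into)

lemma chart_continuous_map:
  "c \<in> A \<Longrightarrow> continuous_map (subtopology M (fst c)) euclidean (snd c)"
  using chart_homeomorphic[of c]
  by (auto simp: homeomorphic_eq_everything_map continuous_map_in_subtopology)

lemma chart_inv_continuous_map:
  assumes "c \<in> A"
  shows "continuous_map (top_of_set (snd c ` fst c)) M (chart_inv c)"
proof -
  obtain g where g: "homeomorphic_maps (subtopology M (fst c)) (top_of_set (snd c ` fst c)) (snd c) g"
    using chart_homeomorphic[OF assms] homeomorphic_map_maps by blast
  have "continuous_map (top_of_set (snd c ` fst c)) M g"
    using g by (auto simp: homeomorphic_maps_def continuous_map_in_subtopology)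
  moreover have "g z = chart_inv c z" if "z \<in> snd c ` fst c" for z
    using g that assms chart_subset[OF assms]
    by (auto simp: homeomorphic_maps_def)
  ultimately show ?thesis
    by (metis (no_types, lifting) continuous_map_eq topspace_euclidean_subtopology)
qed

lemma chart_image_open:
  assumes "c \<in> A" "openin M U"
  shows "open (snd c ` (fst c \<inter> U))"
proof -
  have "openin (subtopology M (fst c)) (fst c \<inter> U)"
    using assms(2) by (simp add: openin_subtopology_Int2)
  then have "openin (top_of_set (snd c ` fst c)) (snd c ` (fst c \<inter> U))"
    using chart_homeomorphic[OF assms(1)]
    by (metis homeomorphic_map_openness openin_subset)
  then show ?thesis
    using chart_open[OF assms(1)] openin_open_eq by blast
qed

lemma chart_preimage_open:
  assumes "c \<in> A" "open V"
  shows "openin M {p \<in> fst c. snd c p \<in> V}"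
proof -
  have "openin (subtopology M (fst c)) {p \<in> topspace (subtopology M (fst c)). snd c p \<in> V}"
    using chart_continuous_map[OF assms(1)] assms(2) by (auto simp: continuous_map_def)
  moreover have "topspace (subtopology M (fst c)) = fst c"
    using chart_subset[OF assms(1)] by auto
  ultimately show ?thesis
    using chart_openin[OF assms(1)] openin_trans_full by fastforce
qed

section \<open>Transition maps, differentials and tangent vectors\<close>

lemma transition_smooth:
  assumes "c \<in> A" "d \<in> A"
  shows "smooth_on (snd c ` (fst c \<inter> fst d)) (snd d \<circ> chart_inv c)"
  using surface assms by (auto simp: smooth_surface_def smooth_compatible_def smooth_transition_def)

lemma transition_open:
  assumes "c \<in> A" "d \<in> A"
  shows "open (snd c ` (fst c \<inter> fst d))"
  using chart_image_open[OF assms(1) chart_openin[OF assms(2)]] .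

lemma transition_has_derivative:
  assumes "c \<in> charts_at A p" "d \<in> charts_at A p"
  shows "((snd d \<circ> chart_inv c) has_derivative
           frechet_derivative (snd d \<circ> chart_inv c) (at (snd c p))) (at (snd c p))"
  by (rule frechet_derivative_has_derivative[OF transition_smooth])
     (use assms in \<open>auto simp: charts_at_def\<close>)

text \<open>On the image of the overlap, which is open, \<open>h \<circ> chart_inv c\<close> factors
  through the transition map, so this is the chain rule. With \<open>h\<close> the coordinate map of
  a third chart it is the cocycle rule for transition maps.\<close>

lemma frechet_derivative_change_chart:
  assumes c: "c \<in> charts_at A p" and d: "d \<in> charts_at A p"
    and h: "(h \<circ> chart_inv d) differentiable (at (snd d p))"
  shows "((h \<circ> chart_inv c) has_derivative
     (\<lambda>v. frechet_derivative (h \<circ> chart_inv d) (at (snd d p))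
        (frechet_derivative (snd d \<circ> chart_inv c) (at (snd c p)) v))) (at (snd c p))"
    and "frechet_derivative (h \<circ> chart_inv c) (at (snd c p)) v
      = frechet_derivative (h \<circ> chart_inv d) (at (snd d p))
          (frechet_derivative (snd d \<circ> chart_inv c) (at (snd c p)) v)"
proof -
  have cA: "c \<in> A" "p \<in> fst c" and dA: "d \<in> A" "p \<in> fst d"
    using c d by (auto simp: charts_at_def)
  have eq: "(snd d \<circ> chart_inv c) (snd c p) = snd d p" using cA by simp
  have "((h \<circ> chart_inv d) has_derivative frechet_derivative (h \<circ> chart_inv d) (at (snd d p)))
      (at ((snd d \<circ> chart_inv c) (snd c p)))"
    using h frechet_derivative_works unfolding eq by blast
  from diff_chain_at[OF transition_has_derivative[OF c d] this]
  have D: "((h \<circ> chart_inv d) \<circ> (snd d \<circ> chart_inv c) has_derivative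
     frechet_derivative (h \<circ> chart_inv d) (at (snd d p)) \<circ>
        frechet_derivative (snd d \<circ> chart_inv c) (at (snd c p))) (at (snd c p))" .
  show H: "((h \<circ> chart_inv c) has_derivative
     (\<lambda>v. frechet_derivative (h \<circ> chart_inv d) (at (snd d p))
        (frechet_derivative (snd d \<circ> chart_inv c) (at (snd c p)) v))) (at (snd c p))"
  proof (rule has_derivative_transform_within_open)
    show "((h \<circ> chart_inv d) \<circ> (snd d \<circ> chart_inv c) has_derivative
     (\<lambda>v. frechet_derivative (h \<circ> chart_inv d) (at (snd d p))
        (frechet_derivative (snd d \<circ> chart_inv c) (at (snd c p)) v))) (at (snd c p))"
      using D by (simp add: o_def)
    show "open (snd c ` (fst c \<inter> fst d))" using transition_open cA dA by simp
    show "snd c p \<in> snd c ` (fst c \<inter> fst d)" using cA dA by simp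
  qed (use cA dA in auto)
  show "frechet_derivative (h \<circ> chart_inv c) (at (snd c p)) v
      = frechet_derivative (h \<circ> chart_inv d) (at (snd d p))
          (frechet_derivative (snd d \<circ> chart_inv c) (at (snd c p)) v)"
    using frechet_derivative_at[OF H] by metis
qed

lemma smooth_map_has_derivative:
  assumes "smooth_map A h" "c \<in> charts_at A p"
  shows "((h \<circ> chart_inv c) has_derivative
           frechet_derivative (h \<circ> chart_inv c) (at (snd c p))) (at (snd c p))"
  by (rule frechet_derivative_has_derivative[of "snd c ` fst c"])
     (use assms in \<open>auto simp: smooth_map_def charts_at_def\<close>)

text \<open>\<open>differential\<close> is defined through an arbitrarily chosen chart; the
  transformation rule of tangent vectors and the chain rule cancel, so any chart around
  \<open>p\<close> may be used.\<close>

lemma differential_chart: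
  assumes h: "smooth_map A h" and c: "c \<in> charts_at A p" and X: "X \<in> tangent_space A p"
  shows "differential A h p X = frechet_derivative (h \<circ> chart_inv c) (at (snd c p)) (X c)"
proof -
  define d where "d = (SOME d. d \<in> charts_at A p)"
  have d: "d \<in> charts_at A p" unfolding d_def using c by (rule someI)
  have Xd: "X d = frechet_derivative (snd d \<circ> chart_inv c) (at (snd c p)) (X c)"
    using X c d unfolding tangent_space_def by blast
  have "differential A h p X = frechet_derivative (h \<circ> chart_inv d) (at (snd d p)) (X d)"
    by (simp only: differential_def Let_def d_def)
  also have "\<dots> = frechet_derivative (h \<circ> chart_inv c) (at (snd c p)) (X c)"
    unfolding Xd
    by (rule frechet_derivative_change_chart(2)[OF c d, symmetric])
       (rule differentiableI[OF smooth_map_has_derivative[OF h d]])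
  finally show ?thesis .
qed

text \<open>By the cocycle rule, compatibility with the one chart \<open>c\<close> implies
  compatibility between any two charts around \<open>p\<close>.\<close>

lemma tangent_spaceI:
  assumes c: "c \<in> charts_at A p"
    and X: "\<And>d. d \<in> charts_at A p \<Longrightarrow>
      X d = frechet_derivative (snd d \<circ> chart_inv c) (at (snd c p)) v"
    and "\<And>d. d \<notin> charts_at A p \<Longrightarrow> X d = 0"
  shows "X \<in> tangent_space A p"
proof -
  have "X e = frechet_derivative (snd e \<circ> chart_inv d) (at (snd d p)) (X d)"
    if "d \<in> charts_at A p" "e \<in> charts_at A p" for d e
  proof -
    have "(snd e \<circ> chart_inv d) differentiable (at (snd d p))"
      using transition_has_derivative[OF that] by (rule differentiableI)
    from frechet_derivative_change_chart(2)[OF c that(1) this, of v] show ?thesis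
      unfolding X[OF that(1)] X[OF that(2)] .
  qed
  then show ?thesis using assms(3) unfolding tangent_space_def by blast
qed

lemma coord_vector_in_tangent_space:
  assumes "c \<in> charts_at A p"
  shows "coord_vector A c p v \<in> tangent_space A p"
  by (rule tangent_spaceI[OF assms]) (auto simp: coord_vector_def)

lemma coord_vector_chart [simp]:
  assumes "c \<in> charts_at A p"
  shows "coord_vector A c p v c = v"
proof -
  have cA: "c \<in> A" "p \<in> fst c" using assms by (auto simp: charts_at_def)
  have "((snd c \<circ> chart_inv c) has_derivative (\<lambda>v. v)) (at (snd c p))"
    by (rule has_derivative_transform_within_open[OF has_derivative_ident chart_open[OF cA(1)]])
       (use cA chart_inv_right in auto)
  from frechet_derivative_at[OF this] show ?thesis
    using assms by (simp add: coord_vector_def) metis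
qed

end

section \<open>Piecewise continuously differentiable curves\<close>

text \<open>Exposes the finite set of break points hidden in \<open>piecewise_C1_path\<close>, so
  that several facts about a curve can refer to the same set.\<close>

definition C1_except :: "'a chart set \<Rightarrow> (real \<Rightarrow> 'a) \<Rightarrow> real set \<Rightarrow> bool" where
  "C1_except A \<gamma> S \<longleftrightarrow> finite S \<and> (\<forall>a b. 0 \<le> a \<and> a < b \<and> b \<le> 1 \<and> {a<..<b} \<inter> S = {}
     \<longrightarrow> C1_curve_on A \<gamma> {a..b})"

lemma piecewise_C1_path_altdef:
  "piecewise_C1_path M A \<gamma> \<longleftrightarrow> pathin M \<gamma> \<and> (\<exists>S. C1_except A \<gamma> S)"
  by (auto simp: piecewise_C1_path_def C1_except_def)

text \<open>\<open>G z v\<close> is the squared norm of the vector with component \<open>v\<close>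
  at the point with coordinate \<open>z\<close>. Joint continuity makes the speed of a C1 curve
  continuous, homogeneity governs reparametrisation, and positivity separates points.\<close>

definition metric_in_chart :: "'a chart set \<Rightarrow> 'a form \<Rightarrow> 'a chart \<Rightarrow> (complex \<Rightarrow> complex \<Rightarrow> real) \<Rightarrow> bool"
  where "metric_in_chart A g c G \<longleftrightarrow>
     continuous_on (snd c ` fst c \<times> UNIV) (\<lambda>(z, v). G z v) \<and>
     (\<forall>z\<in>snd c ` fst c. \<forall>v r. G z (r *\<^sub>R v) = r\<^sup>2 * G z v) \<and>
     (\<forall>z\<in>snd c ` fst c. \<forall>v. v \<noteq> 0 \<longrightarrow> G z v > 0) \<and>
     (\<forall>p\<in>fst c. \<forall>X\<in>tangent_space A p. g p X X = G (snd c p) (X c))"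

definition continuous_metric :: "'a chart set \<Rightarrow> 'a form \<Rightarrow> bool" where
  "continuous_metric A g \<longleftrightarrow> (\<forall>c\<in>A. \<exists>G. metric_in_chart A g c G)"

lemma metric_in_chart_nonneg:
  assumes "metric_in_chart A g c G" "z \<in> snd c ` fst c"
  shows "G z v \<ge> 0"
proof (cases "v = 0")
  case True
  have "G z (0 *\<^sub>R v) = 0\<^sup>2 * G z v" using assms unfolding metric_in_chart_def by blast
  then show ?thesis using True by simp
next
  case False
  then show ?thesis using assms unfolding metric_in_chart_def by (metis less_imp_le)
qed

definition speed :: "'a chart set \<Rightarrow> 'a form \<Rightarrow> (real \<Rightarrow> 'a) \<Rightarrow> real \<Rightarrow> real" where
  "speed A g \<gamma> t = sqrt (g (\<gamma> t) (velocity A \<gamma> t) (velocity A \<gamma> t))"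

lemma curve_length_eq: "curve_length A g \<gamma> = integral {0..1} (speed A g \<gamma>)"
  by (simp add: curve_length_def speed_def[abs_def])

context surface
begin

section \<open>Velocity, speed and integrability of the speed\<close>

lemma pathin_topspace: "pathin M \<gamma> \<Longrightarrow> t \<in> {0..1} \<Longrightarrow> \<gamma> t \<in> topspace M"
  using path_image_subset_topspace by fastforce

lemma pathin_near:
  assumes \<gamma>: "pathin M \<gamma>" and U: "openin M U" and t: "t \<in> {0..1}" "\<gamma> t \<in> U"
  shows "\<exists>d>0. \<forall>s\<in>{0..1}. \<bar>s - t\<bar> < d \<longrightarrow> \<gamma> s \<in> U"
proof -
  have "openin (top_of_set {0..1}) {s \<in> {0..1}. \<gamma> s \<in> U}"
    using \<gamma> U by (auto simp: pathin_def continuous_map_def)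
  then obtain T where T: "open T" "{s \<in> {0..1}. \<gamma> s \<in> U} = {0..1} \<inter> T"
    by (auto simp: openin_open)
  then obtain d where "d > 0" "\<And>s. dist s t < d \<Longrightarrow> s \<in> T"
    using t unfolding open_dist by blast
  then show ?thesis using T(2) by (auto simp: dist_real_def)
qed

text \<open>Near \<open>t\<close> the curve stays in the domain of \<open>c\<close>, so the part of
  the interval on which \<open>C1_curve_on\<close> speaks about \<open>c\<close> is the whole
  interval. Break points are excluded from the interior of the interval only: they may be its ends,
  where the derivative is one-sided.\<close>

lemma local_C1:
  assumes \<gamma>: "pathin M \<gamma>" and S: "C1_except A \<gamma> S" and t: "t \<in> {0..1}"
    and c: "c \<in> charts_at A (\<gamma> t)"
  obtains d where "d > 0"
    and "\<And>u v. \<lbrakk>0 \<le> u; u < v; v \<le> 1; {u..v} \<subseteq> ball t d; {u<..<v} \<inter> S = {}\<rbrakk> \<Longrightarrow> \<gamma> ` {u..v} \<subseteq> fst c"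
    and "\<And>u v. \<lbrakk>0 \<le> u; u < v; v \<le> 1; {u..v} \<subseteq> ball t d; {u<..<v} \<inter> S = {}\<rbrakk> \<Longrightarrow>
       \<exists>D. continuous_on {u..v} D \<and>
         (\<forall>s\<in>{u..v}. ((snd c \<circ> \<gamma>) has_vector_derivative D s) (at s within {u..v}))"
proof -
  have cA: "c \<in> A" "\<gamma> t \<in> fst c" using c by (auto simp: charts_at_def)
  obtain d where d: "d > 0" "\<And>s. s \<in> {0..1} \<Longrightarrow> \<bar>s - t\<bar> < d \<Longrightarrow> \<gamma> s \<in> fst c"
    using pathin_near[OF \<gamma> chart_openin[OF cA(1)] t cA(2)] by blast
  have sub: "\<gamma> s \<in> fst c"
    if "0 \<le> u" "v \<le> 1" "{u..v} \<subseteq> ball t d" "s \<in> {u..v}" for u v s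
  proof -
    have "s \<in> ball t d" using that by blast
    then show ?thesis using d(2)[of s] that by (auto simp: dist_real_def abs_minus_commute)
  qed
  show thesis
  proof (rule that[OF d(1)])
    fix u v assume uv: "0 \<le> u" "u < v" "v \<le> 1" "{u..v} \<subseteq> ball t d" "{u<..<v} \<inter> S = {}"
    show "\<gamma> ` {u..v} \<subseteq> fst c" using sub[OF uv(1,3,4)] by blast
    have "C1_curve_on A \<gamma> {u..v}"
      using S uv unfolding C1_except_def by blast
    moreover have T: "{s \<in> {u..v}. \<gamma> s \<in> fst c} = {u..v}" using sub[OF uv(1,3,4)] by blast
    ultimately show "\<exists>D. continuous_on {u..v} D \<and>
       (\<forall>s\<in>{u..v}. ((snd c \<circ> \<gamma>) has_vector_derivative D s) (at s within {u..v}))"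
      using cA(1) unfolding C1_curve_on_def Let_def by (elim ballE[of _ _ c]) (simp_all only: T)
  qed
qed

text \<open>Off the break points, \<open>t\<close> is interior to an interval on which the curve is
  C1, so the derivative within {0..1} in \<open>velocity\<close> is a two-sided derivative.\<close>

lemma velocity_derivative:
  assumes \<gamma>: "pathin M \<gamma>" and S: "C1_except A \<gamma> S" and t: "t \<in> {0<..<1} - S"
    and c: "c \<in> charts_at A (\<gamma> t)"
  shows "((snd c \<circ> \<gamma>) has_vector_derivative velocity A \<gamma> t c) (at t)"
proof -
  have t01: "t \<in> {0..1}" using t by auto
  obtain d where d: "d > 0"
    and D: "\<And>u v. \<lbrakk>0 \<le> u; u < v; v \<le> 1; {u..v} \<subseteq> ball t d; {u<..<v} \<inter> S = {}\<rbrakk> \<Longrightarrow>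
       \<exists>D. continuous_on {u..v} D \<and>
         (\<forall>s\<in>{u..v}. ((snd c \<circ> \<gamma>) has_vector_derivative D s) (at s within {u..v}))"
    by (rule local_C1[OF \<gamma> S t01 c]) blast
  have "finite S" using S by (simp add: C1_except_def)
  from finite_set_avoid[OF this] obtain e where e: "e > 0" "\<And>s. s \<in> S \<Longrightarrow> s \<noteq> t \<Longrightarrow> e \<le> dist t s"
    by metis
  \<comment> \<open>The four bounds keep the interval of radius \<open>r\<close> around
    \<open>t\<close> inside the neighbourhood of \<open>local_C1\<close>, free of other break
    points, and inside (0,1).\<close>
  define r where "r = min (min (d/2) e) (min (t/2) ((1 - t)/2))"
  have r: "r > 0" using t d e(1) by (simp add: r_def)
  have "r \<le> d/2 \<and> r \<le> e \<and> r \<le> t / 2 \<and> r \<le> (1 - t) / 2" unfolding r_def by linarith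
  then have rt: "2 * r \<le> d" "r \<le> e" "2 * r \<le> t" "2 * r \<le> 1 - t" by auto
  have "t \<notin> S" using t by blast
  have "s = t" if "s \<in> {t - r<..<t + r} \<inter> S" for s
    using e(2)[of s] that rt(2) by (force simp: dist_real_def)
  then have "{t - r<..<t + r} \<inter> S = {}" using \<open>t \<notin> S\<close> by blast
  moreover have "{t - r..t + r} \<subseteq> ball t d"
    using r rt(1) by (auto simp: dist_real_def abs_less_iff)
  ultimately have "\<exists>D. continuous_on {t - r..t + r} D \<and>
      (\<forall>s\<in>{t - r..t + r}. ((snd c \<circ> \<gamma>) has_vector_derivative D s) (at s within {t - r..t + r}))"
    using r rt by (intro D) auto
  then obtain D' where D': "\<And>s. s \<in> {t - r..t + r} \<Longrightarrow>
      ((snd c \<circ> \<gamma>) has_vector_derivative D' s) (at s within {t - r..t + r})"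
    by blast
  have "((snd c \<circ> \<gamma>) has_vector_derivative D' t) (at t)"
    using D'[of t] r by (simp add: at_within_Icc_at)
  moreover have "velocity A \<gamma> t c = vector_derivative (snd c \<circ> \<gamma>) (at t)"
    using c t by (simp add: velocity_def at_within_Icc_at)
  ultimately show ?thesis using vector_derivative_at by metis
qed

text \<open>As long as the curve stays in the domain of \<open>c\<close>, its expression in
  \<open>d\<close> is the transition map after its expression in \<open>c\<close>. The chain rule
  and uniqueness of derivatives give the transformation rule.\<close>

lemma velocity_tangent:
  assumes \<gamma>: "pathin M \<gamma>" and S: "C1_except A \<gamma> S" and t: "t \<in> {0<..<1} - S"
  shows "velocity A \<gamma> t \<in> tangent_space A (\<gamma> t)"
proof -
  have t01: "t \<in> {0..1}" using t by auto
  obtain c where c: "c \<in> charts_at A (\<gamma> t)"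
    using chart_exists[OF pathin_topspace[OF \<gamma> t01]] by blast
  have cA: "c \<in> A" "\<gamma> t \<in> fst c" using c by (auto simp: charts_at_def)
  show ?thesis
  proof (rule tangent_spaceI[OF c])
    fix d assume d: "d \<in> charts_at A (\<gamma> t)"
    have dA: "d \<in> A" "\<gamma> t \<in> fst d" using d by (auto simp: charts_at_def)
    have "((snd d \<circ> chart_inv c) \<circ> (snd c \<circ> \<gamma>) has_vector_derivative
        frechet_derivative (snd d \<circ> chart_inv c) (at (snd c (\<gamma> t))) (velocity A \<gamma> t c)) (at t)"
      using vector_derivative_diff_chain_within[OF velocity_derivative[OF \<gamma> S t c]]
        transition_has_derivative[OF c d] has_derivative_at_withinI by fastforce
    moreover
    obtain e where e: "e > 0" "\<And>s. s \<in> {0..1} \<Longrightarrow> \<bar>s - t\<bar> < e \<Longrightarrow> \<gamma> s \<in> fst c"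
      using pathin_near[OF \<gamma> chart_openin[OF cA(1)] t01 cA(2)] by blast
    ultimately have "((snd d \<circ> \<gamma>) has_vector_derivative
        frechet_derivative (snd d \<circ> chart_inv c) (at (snd c (\<gamma> t))) (velocity A \<gamma> t c)) (at t)"
      using t cA
      by (elim has_vector_derivative_transform_within_open[where S = "{0<..<1} \<inter> ball t e"])
         (auto simp: dist_real_def abs_minus_commute)
    then show "velocity A \<gamma> t d =
        frechet_derivative (snd d \<circ> chart_inv c) (at (snd c (\<gamma> t))) (velocity A \<gamma> t c)"
      using vector_derivative_unique_at velocity_derivative[OF \<gamma> S t d] by blast
  qed (simp add: velocity_def)
qed

lemma speed_in_chart:
  assumes "pathin M \<gamma>" "C1_except A \<gamma> S" "t \<in> {0<..<1} - S"
    and "c \<in> charts_at A (\<gamma> t)" "metric_in_chart A g c G"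
  shows "speed A g \<gamma> t = sqrt (G (snd c (\<gamma> t)) (velocity A \<gamma> t c))"
  using velocity_tangent[OF assms(1-3)] assms(4,5)
  by (auto simp: speed_def metric_in_chart_def charts_at_def)

lemma speed_nonneg:
  assumes "continuous_metric A g" "pathin M \<gamma>" "C1_except A \<gamma> S" "t \<in> {0<..<1} - S"
  shows "speed A g \<gamma> t \<ge> 0"
proof -
  obtain c where c: "c \<in> charts_at A (\<gamma> t)"
    using chart_exists[OF pathin_topspace[OF assms(2)]] assms(4) by fastforce
  then obtain G where G: "metric_in_chart A g c G"
    using assms(1) by (auto simp: continuous_metric_def charts_at_def)
  have "snd c (\<gamma> t) \<in> snd c ` fst c" using c by (auto simp: charts_at_def)
  then show ?thesis
    using metric_in_chart_nonneg[OF G] unfolding speed_in_chart[OF assms(2-4) c G] by simp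
qed

text \<open>With the continuous \<open>D\<close> in place of the velocity, the speed becomes
  continuous on the closed interval. The two functions can differ only at break points and at the
  ends, hence at finitely many points.\<close>

lemma speed_integrable_local:
  assumes g: "continuous_metric A g" and \<gamma>: "pathin M \<gamma>" and S: "C1_except A \<gamma> S"
    and c: "c \<in> A" "\<gamma> ` {u..v} \<subseteq> fst c" and uv: "0 \<le> u" "u < v" "v \<le> 1"
    and D: "continuous_on {u..v} D"
      "\<And>s. s \<in> {u..v} \<Longrightarrow> ((snd c \<circ> \<gamma>) has_vector_derivative D s) (at s within {u..v})"
  shows "speed A g \<gamma> integrable_on {u..v}"
proof -
  obtain G where G: "metric_in_chart A g c G"
    using g c by (auto simp: continuous_metric_def)
  have cont: "continuous_on {u..v} (snd c \<circ> \<gamma>)"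
    unfolding continuous_on_eq_continuous_within
    using D(2) has_vector_derivative_continuous by blast
  have "continuous_on (snd c ` fst c \<times> UNIV) (\<lambda>x. G (fst x) (snd x))"
    using G by (simp add: metric_in_chart_def case_prod_unfold)
  then have "continuous_on {u..v} (\<lambda>s. G (fst ((snd c \<circ> \<gamma>) s, D s)) (snd ((snd c \<circ> \<gamma>) s, D s)))"
    by (rule continuous_on_compose2[OF _ continuous_on_Pair[OF cont D(1)]]) (use c in auto)
  then have "continuous_on {u..v} (\<lambda>s. sqrt (G (snd c (\<gamma> s)) (D s)))"
    by (intro continuous_intros) simp
  then have int: "(\<lambda>s. sqrt (G (snd c (\<gamma> s)) (D s))) integrable_on {u..v}"
    by (rule integrable_continuous_interval)
  show ?thesis
  proof (rule integrable_spike_finite[OF _ _ int])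
    show "finite (S \<union> {u, v})" using S by (simp add: C1_except_def)
    fix s assume "s \<in> {u..v} - (S \<union> {u, v})"
    then have s: "s \<in> {u<..<v}" "s \<in> {0<..<1} - S" using uv by auto
    have cs: "c \<in> charts_at A (\<gamma> s)" using c s by (auto simp: charts_at_def)
    have "((snd c \<circ> \<gamma>) has_vector_derivative D s) (at s)"
      using D(2)[of s] s by (simp add: at_within_Icc_at)
    then have "velocity A \<gamma> s c = D s"
      using velocity_derivative[OF \<gamma> S s(2) cs] vector_derivative_unique_at by blast
    then show "speed A g \<gamma> s = sqrt (G (snd c (\<gamma> s)) (D s))"
      using speed_in_chart[OF \<gamma> S s(2) cs G] by simp
  qed
qed

text \<open>Integrability on a compact interval is a local property: it suffices to find, for each
  \<open>t\<close>, a radius such that the speed is integrable on all subintervals of that size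
  containing \<open>t\<close>. This avoids choosing a subdivision adapted to a cover by
  charts.\<close>

lemma speed_integrable:
  assumes g: "continuous_metric A g" and \<gamma>: "pathin M \<gamma>" and S: "C1_except A \<gamma> S"
  shows "speed A g \<gamma> integrable_on {0..1}"
proof -
  have "speed A g \<gamma> integrable_on cbox 0 1"
  proof (rule integrable_on_little_subintervals, rule ballI)
    fix t :: real assume "t \<in> cbox 0 1"
    then have t: "t \<in> {0..1}" by simp
    obtain c where c: "c \<in> charts_at A (\<gamma> t)"
      using chart_exists[OF pathin_topspace[OF \<gamma> t]] by blast
    have cA: "c \<in> A" using c by (auto simp: charts_at_def)
    obtain d where d: "d > 0"
      and sub: "\<And>u v. \<lbrakk>0 \<le> u; u < v; v \<le> 1; {u..v} \<subseteq> ball t d; {u<..<v} \<inter> S = {}\<rbrakk> \<Longrightarrow> \<gamma> ` {u..v} \<subseteq> fst c"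
      and D: "\<And>u v. \<lbrakk>0 \<le> u; u < v; v \<le> 1; {u..v} \<subseteq> ball t d; {u<..<v} \<inter> S = {}\<rbrakk> \<Longrightarrow>
       \<exists>D. continuous_on {u..v} D \<and>
         (\<forall>s\<in>{u..v}. ((snd c \<circ> \<gamma>) has_vector_derivative D s) (at s within {u..v}))"
      by (rule local_C1[OF \<gamma> S t c]) blast
    have "finite S" using S by (simp add: C1_except_def)
    from finite_set_avoid[OF this] obtain e where e: "e > 0" "\<And>s. s \<in> S \<Longrightarrow> s \<noteq> t \<Longrightarrow> e \<le> dist t s"
      by metis
    \<comment> \<open>Within distance \<open>e\<close> the only possible break point is
      \<open>t\<close> itself; as it is not interior to the interval, the interior contains
      none.\<close>
    have piece: "speed A g \<gamma> integrable_on {u..v}"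
      if "0 \<le> u" "u \<le> v" "v \<le> 1" "{u..v} \<subseteq> ball t (min d e)" "t \<notin> {u<..<v}" for u v
    proof (cases "u = v")
      case True
      then show ?thesis using integrable_on_refl[of _ u] by simp
    next
      case False
      then have uv: "u < v" using that by simp
      have "s \<notin> S" if "s \<in> {u<..<v}" for s
      proof
        assume "s \<in> S"
        have "s \<in> ball t (min d e)" using \<open>{u..v} \<subseteq> _\<close> that by fastforce
        moreover have "s \<noteq> t" using that \<open>t \<notin> _\<close> by blast
        ultimately show False using e(2)[OF \<open>s \<in> S\<close>] by auto
      qed
      then have *: "{u<..<v} \<inter> S = {}" by blast
      have sub': "{u..v} \<subseteq> ball t d" using that(4) by auto
      obtain D' where "continuous_on {u..v} D'"
        "\<And>s. s \<in> {u..v} \<Longrightarrow> ((snd c \<circ> \<gamma>) has_vector_derivative D' s) (at s within {u..v})"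
        using D[OF \<open>0 \<le> u\<close> uv \<open>v \<le> 1\<close> sub' *] by metis
      then show ?thesis
        using speed_integrable_local[OF g \<gamma> S cA sub[OF \<open>0 \<le> u\<close> uv \<open>v \<le> 1\<close> sub' *] \<open>0 \<le> u\<close> uv \<open>v \<le> 1\<close>]
        by blast
    qed
    show "\<exists>d>0. \<forall>u v. t \<in> cbox u v \<and> cbox u v \<subseteq> ball t d \<and> cbox u v \<subseteq> cbox 0 1 \<longrightarrow>
        speed A g \<gamma> integrable_on cbox u v"
    proof (intro exI[of _ "min d e"] conjI allI impI)
      \<comment> \<open>Since \<open>t\<close> may be a break point, the interval is split there and
        each half is treated by \<open>piece\<close>.\<close>
      fix u v assume *: "t \<in> cbox u v \<and> cbox u v \<subseteq> ball t (min d e) \<and> cbox u v \<subseteq> cbox 0 1"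
      then have "0 \<le> u" "u \<le> t" "t \<le> v" "v \<le> 1" by auto
      moreover have "{u..t} \<subseteq> ball t (min d e)" "{t..v} \<subseteq> ball t (min d e)"
        using * by (metis \<open>t \<le> v\<close> \<open>u \<le> t\<close> atLeastatMost_subset_iff dual_order.refl interval_cbox order_trans)+
      ultimately have "speed A g \<gamma> integrable_on {u..t}" "speed A g \<gamma> integrable_on {t..v}"
        by (auto intro!: piece)
      then show "speed A g \<gamma> integrable_on cbox u v"
        using Henstock_Kurzweil_Integration.integrable_combine[OF \<open>u \<le> t\<close> \<open>t \<le> v\<close>] by simp
    qed (use d e in simp)
  qed
  then show ?thesis by simp
qed

section \<open>Sign and comparison of lengths\<close>

text \<open>At a break point the velocity is unspecified and need not be tangent, and
  \<open>sqrt\<close> of a negative number is negative. The integrand is therefore replaced by 0 at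
  the break points and at the ends, which does not change the integral.\<close>

lemma curve_length_nonneg:
  assumes g: "continuous_metric A g" and \<gamma>: "piecewise_C1_path M A \<gamma>"
  shows "curve_length A g \<gamma> \<ge> 0"
proof -
  obtain S where \<gamma>: "pathin M \<gamma>" and S: "C1_except A \<gamma> S"
    using \<gamma> by (auto simp: piecewise_C1_path_altdef)
  have fin: "finite (S \<union> {0, 1})" using S by (simp add: C1_except_def)
  have "((\<lambda>t. if t \<in> S \<union> {0, 1} then 0 else speed A g \<gamma> t) has_integral curve_length A g \<gamma>) {0..1}"
    using has_integral_spike_finite[OF fin _ integrable_integral[OF speed_integrable[OF g \<gamma> S]]]
    by (simp add: curve_length_eq)
  then show ?thesis
    by (rule has_integral_nonneg) (use speed_nonneg[OF g \<gamma> S] in auto)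
qed

lemma curve_length_le:
  assumes g: "continuous_metric A g" and h: "continuous_metric A h" and C: "C \<ge> 0"
    and le: "\<And>p X. p \<in> topspace M \<Longrightarrow> X \<in> tangent_space A p \<Longrightarrow> g p X X \<le> C\<^sup>2 * h p X X"
    and \<gamma>: "piecewise_C1_path M A \<gamma>"
  shows "curve_length A g \<gamma> \<le> C * curve_length A h \<gamma>"
proof -
  obtain S where \<gamma>: "pathin M \<gamma>" and S: "C1_except A \<gamma> S"
    using \<gamma> by (auto simp: piecewise_C1_path_altdef)
  have fin: "finite (S \<union> {0, 1})" using S by (simp add: C1_except_def)
  have 1: "((\<lambda>t. if t \<in> S \<union> {0, 1} then 0 else speed A g \<gamma> t) has_integral curve_length A g \<gamma>) {0..1}"
    using has_integral_spike_finite[OF fin _ integrable_integral[OF speed_integrable[OF g \<gamma> S]]]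
    by (simp add: curve_length_eq)
  have 2: "((\<lambda>t. if t \<in> S \<union> {0, 1} then 0 else C * speed A h \<gamma> t) has_integral C * curve_length A h \<gamma>) {0..1}"
    using has_integral_spike_finite[OF fin _ has_integral_mult_right[OF integrable_integral[OF speed_integrable[OF h \<gamma> S]]]]
    by (simp add: curve_length_eq)
  show ?thesis
  proof (rule has_integral_le[OF 1 2])
    fix t :: real assume t: "t \<in> {0..1}"
    show "(if t \<in> S \<union> {0, 1} then 0 else speed A g \<gamma> t) \<le> (if t \<in> S \<union> {0, 1} then 0 else C * speed A h \<gamma> t)"
    proof (cases "t \<in> S \<union> {0, 1}")
      case False
      then have "t \<in> {0<..<1} - S" using t by auto
      from le[OF pathin_topspace[OF \<gamma> t] velocity_tangent[OF \<gamma> S this]]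
      have "speed A g \<gamma> t \<le> sqrt (C\<^sup>2 * h (\<gamma> t) (velocity A \<gamma> t) (velocity A \<gamma> t))"
        unfolding speed_def by simp
      also have "\<dots> = C * speed A h \<gamma> t"
        using C by (simp add: speed_def real_sqrt_mult)
      finally show ?thesis using False by simp
    qed simp
  qed
qed

end

section \<open>Concatenation of curves\<close>

text \<open>Used with m = -1, k = 1 for the reversed curve, and with m = 2, k = 0 or -1 for the two
  halves of a concatenation.\<close>

lemma C1_curve_on_affine:
  assumes \<delta>: "C1_curve_on A \<delta> J'"
    and J: "\<And>s. s \<in> J \<Longrightarrow> m * s + k \<in> J'" "\<And>s. s \<in> J \<Longrightarrow> \<gamma> s = \<delta> (m * s + k)"
  shows "C1_curve_on A \<gamma> J"
  unfolding C1_curve_on_def Let_def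
proof
  fix c assume c: "c \<in> A"
  define T' where "T' = {t \<in> J'. \<delta> t \<in> fst c}"
  define T where "T = {t \<in> J. \<gamma> t \<in> fst c}"
  obtain D where D: "continuous_on T' D"
    "\<And>t. t \<in> T' \<Longrightarrow> ((snd c \<circ> \<delta>) has_vector_derivative D t) (at t within T')"
    using \<delta> c unfolding C1_curve_on_def Let_def T'_def by blast
  have TT: "(\<lambda>s. m * s + k) ` T \<subseteq> T'"
    using J by (auto simp: T_def T'_def)
  have "continuous_on T (\<lambda>s. m *\<^sub>R D (m * s + k))"
    by (intro continuous_intros continuous_on_compose2[OF D(1)] TT)
  moreover have "((snd c \<circ> \<gamma>) has_vector_derivative m *\<^sub>R D (m * s + k)) (at s within T)"
    if s: "s \<in> T" for s
  proof (rule has_vector_derivative_transform[OF s])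
    have 1: "((\<lambda>s. m * s + k) has_vector_derivative m) (at s within T)"
      by (auto intro!: derivative_eq_intros)
    have "((snd c \<circ> \<delta>) has_vector_derivative D (m * s + k)) (at (m * s + k) within (\<lambda>s. m * s + k) ` T)"
      using D(2)[of "m * s + k"] TT s by (blast intro: has_vector_derivative_within_subset)
    from vector_diff_chain_within[OF 1 this]
    show "((snd c \<circ> \<delta> \<circ> (\<lambda>s. m * s + k)) has_vector_derivative m *\<^sub>R D (m * s + k)) (at s within T)" .
  qed (use J in \<open>auto simp: T_def\<close>)
  ultimately show "\<exists>D. continuous_on {t \<in> J. \<gamma> t \<in> fst c} D \<and>
      (\<forall>t\<in>{t \<in> J. \<gamma> t \<in> fst c}. ((snd c \<circ> \<gamma>) has_vector_derivative D t) (at t within {t \<in> J. \<gamma> t \<in> fst c}))"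
    unfolding T_def[symmetric] by blast
qed

definition path_join :: "(real \<Rightarrow> 'a) \<Rightarrow> (real \<Rightarrow> 'a) \<Rightarrow> real \<Rightarrow> 'a" where
  "path_join \<gamma> \<delta> t = (if t \<le> 1/2 then \<gamma> (2 * t) else \<delta> (2 * t - 1))"

lemma finite_affine_vimage:
  assumes "finite S" "(m::real) \<noteq> 0"
  shows "finite {t. m * t + k \<in> S}"
proof -
  have "{t. m * t + k \<in> S} = (\<lambda>t. m * t + k) -` S" by auto
  moreover have "inj (\<lambda>t. m * t + k)" using assms(2) by (auto simp: inj_def)
  ultimately show ?thesis using finite_vimageI[OF assms(1)] by metis
qed

context surface
begin

lemma tangent_space_scale:
  assumes X: "X \<in> tangent_space A p" and p: "p \<in> topspace M"
  shows "(\<lambda>c. r *\<^sub>R X c) \<in> tangent_space A p"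
proof -
  obtain c where c: "c \<in> charts_at A p" using chart_exists[OF p] by blast
  show ?thesis
  proof (rule tangent_spaceI[OF c])
    fix d assume d: "d \<in> charts_at A p"
    have "X d = frechet_derivative (snd d \<circ> chart_inv c) (at (snd c p)) (X c)"
      using X c d unfolding tangent_space_def by blast
    then show "r *\<^sub>R X d = frechet_derivative (snd d \<circ> chart_inv c) (at (snd c p)) (r *\<^sub>R X c)"
      using has_derivative_linear[OF transition_has_derivative[OF c d]] by (simp add: linear_scale)
  next
    fix d assume "d \<notin> charts_at A p"
    then have "X d = 0" using X unfolding tangent_space_def by blast
    then show "r *\<^sub>R X d = 0" by simp
  qed
qed

lemma continuous_metric_scale:
  assumes g: "continuous_metric A g" and X: "X \<in> tangent_space A p" and p: "p \<in> topspace M"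
  shows "g p (\<lambda>c. r *\<^sub>R X c) (\<lambda>c. r *\<^sub>R X c) = r\<^sup>2 * g p X X"
proof -
  obtain c where c: "c \<in> charts_at A p" using chart_exists[OF p] by blast
  then have cA: "c \<in> A" "p \<in> fst c" by (auto simp: charts_at_def)
  obtain G where "metric_in_chart A g c G" using g cA by (auto simp: continuous_metric_def)
  then show ?thesis
    using X tangent_space_scale[OF X p, of r] cA by (auto simp: metric_in_chart_def)
qed

lemma velocity_affine:
  assumes \<delta>: "pathin M \<delta>" "C1_except A \<delta> S" "m * t + k \<in> {0<..<1} - S"
    and U: "open U" "t \<in> U" "U \<subseteq> {0..1}" "\<And>s. s \<in> U \<Longrightarrow> \<gamma> s = \<delta> (m * s + k)"
  shows "velocity A \<gamma> t = (\<lambda>c. m *\<^sub>R velocity A \<delta> (m * t + k) c)"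
proof
  fix c
  show "velocity A \<gamma> t c = m *\<^sub>R velocity A \<delta> (m * t + k) c"
  proof (cases "c \<in> charts_at A (\<delta> (m * t + k))")
    case False
    then show ?thesis using U by (simp add: velocity_def)
  next
    case True
    have "((\<lambda>s. m * s + k) has_vector_derivative m) (at t)"
      by (auto intro!: derivative_eq_intros)
    from vector_diff_chain_at[OF this velocity_derivative[OF \<delta> True]]
    have "((snd c \<circ> \<delta> \<circ> (\<lambda>s. m * s + k)) has_vector_derivative m *\<^sub>R velocity A \<delta> (m * t + k) c) (at t)" .
    then have D: "((snd c \<circ> \<gamma>) has_vector_derivative m *\<^sub>R velocity A \<delta> (m * t + k) c) (at t)"
      by (rule has_vector_derivative_transform_within_open[OF _ U(1,2)]) (simp add: U(4))
    have "at t within {0..1} = at t"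
      using U(1-3) by (metis at_within_interior interior_maximal subsetD)
    then show ?thesis
      using True U vector_derivative_at[OF D] by (simp add: velocity_def)
  qed
qed

text \<open>Length is invariant under affine reparametrisation: the factor |m| from the homogeneity
  of the norm cancels the factor 1/|m| of the substitution. The hypothesis \<open>img\<close> says
  that {u..v} is the preimage of {0..1} under \<open>m * t + k\<close>, in the shape in which the
  substitution rule yields its interval.\<close>

lemma speed_affine_has_integral:
  assumes g: "continuous_metric A g" and \<delta>: "pathin M \<delta>" "C1_except A \<delta> S"
    and m: "m \<noteq> 0" and uv: "0 \<le> u" "u < v" "v \<le> 1"
    and img: "(\<lambda>x. x / m - k / m) ` {0..1} = {u..v}"
    and \<gamma>: "\<And>t. t \<in> {u<..<v} \<Longrightarrow> \<gamma> t = \<delta> (m * t + k)"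
  shows "(speed A g \<gamma> has_integral curve_length A g \<delta>) {u..v}"
proof -
  have "((\<lambda>x. speed A g \<delta> (m *\<^sub>R x + k)) has_integral (1 / \<bar>m\<bar> ^ DIM(real)) *\<^sub>R curve_length A g \<delta>)
     ((\<lambda>x. (1 / m) *\<^sub>R x + - ((1 / m) *\<^sub>R k)) ` cbox 0 1)"
    using speed_integrable[OF g \<delta>] m
    by (intro has_integral_affinity) (auto simp: curve_length_eq integrable_integral)
  moreover have "(\<lambda>x. (1 / m) *\<^sub>R x + - ((1 / m) *\<^sub>R k)) ` cbox 0 1 = {u..v}"
    using img by simp
  ultimately have "((\<lambda>x. speed A g \<delta> (m * x + k)) has_integral (1 / \<bar>m\<bar>) * curve_length A g \<delta>) {u..v}"
    by simp
  from has_integral_mult_right[OF this, of "\<bar>m\<bar>"]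
  have int: "((\<lambda>x. \<bar>m\<bar> * speed A g \<delta> (m * x + k)) has_integral curve_length A g \<delta>) {u..v}"
    using m by simp
  have "finite S" using \<delta> by (simp add: C1_except_def)
  then have fin: "finite ({u, v} \<union> {t. m * t + k \<in> S \<union> {0, 1}})"
    using finite_affine_vimage[OF _ m, of "S \<union> {0, 1}" k] by simp
  show ?thesis
  proof (rule has_integral_spike_finite[OF fin _ int])
    fix t assume t: "t \<in> {u..v} - ({u, v} \<union> {t. m * t + k \<in> S \<union> {0, 1}})"
    then obtain x where x: "x \<in> {0..1}" "t = x / m - k / m" using img by blast
    then have "m * t + k = x" using m by (simp add: field_simps)
    then have mt: "m * t + k \<in> {0<..<1} - S" using x(1) t by auto
    have tU: "t \<in> {u<..<v}" using t by auto
    have vel: "velocity A \<gamma> t = (\<lambda>c. m *\<^sub>R velocity A \<delta> (m * t + k) c)"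
      by (rule velocity_affine[OF \<delta> mt _ tU]) (use uv \<gamma> in auto)
    have "\<delta> (m * t + k) \<in> topspace M"
      using pathin_topspace[OF \<delta>(1)] mt by auto
    then show "speed A g \<gamma> t = \<bar>m\<bar> * speed A g \<delta> (m * t + k)"
      unfolding speed_def vel \<gamma>[OF tU]
      using continuous_metric_scale[OF g velocity_tangent[OF \<delta> mt], of m]
      by (simp add: real_sqrt_mult)
  qed
qed

lemma pathin_affine:
  assumes "pathin M \<gamma>" "\<And>t. t \<in> J \<Longrightarrow> m * t + k \<in> {0..1}"
  shows "continuous_map (top_of_set J) M (\<lambda>t. \<gamma> (m * t + k))"
proof -
  have "continuous_map (top_of_set J) (top_of_set {0..1}) (\<lambda>t. m * t + k)"
    using assms(2) by (auto intro!: continuous_intros)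
  from continuous_map_compose[OF this assms(1)[unfolded pathin_def]] show ?thesis
    by (simp add: o_def)
qed

lemma reverse_path:
  assumes \<gamma>: "piecewise_C1_path M A \<gamma>"
  shows "piecewise_C1_path M A (\<lambda>t. \<gamma> (1 - t))"
    and "continuous_metric A g \<Longrightarrow> curve_length A g (\<lambda>t. \<gamma> (1 - t)) = curve_length A g \<gamma>"
proof -
  obtain S where \<gamma>: "pathin M \<gamma>" "C1_except A \<gamma> S"
    using \<gamma> by (auto simp: piecewise_C1_path_altdef)
  have "pathin M (\<lambda>t. \<gamma> (1 - t))"
    using pathin_affine[OF \<gamma>(1), of "{0..1}" "-1" 1] by (simp add: pathin_def algebra_simps)
  moreover have "C1_except A (\<lambda>t. \<gamma> (1 - t)) {t. -1 * t + 1 \<in> S}"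
    unfolding C1_except_def
  proof (intro conjI allI impI)
    show "finite {t. -1 * t + 1 \<in> S}"
      by (rule finite_affine_vimage) (use \<gamma>(2) in \<open>auto simp: C1_except_def\<close>)
    fix a b :: real assume ab: "0 \<le> a \<and> a < b \<and> b \<le> 1 \<and> {a<..<b} \<inter> {t. -1 * t + 1 \<in> S} = {}"
    have "s \<notin> S" if "s \<in> {1 - b<..<1 - a}" for s
    proof -
      have "1 - s \<in> {a<..<b}" using that by auto
      then have "1 - s \<notin> {t. -1 * t + 1 \<in> S}" using ab by blast
      then show ?thesis by simp
    qed
    then have "{1 - b<..<1 - a} \<inter> S = {}" by blast
    then have "C1_curve_on A \<gamma> {1 - b..1 - a}"
      using \<gamma>(2) ab unfolding C1_except_def by auto
    then show "C1_curve_on A (\<lambda>t. \<gamma> (1 - t)) {a..b}"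
      by (rule C1_curve_on_affine[where m = "-1" and k = 1]) auto
  qed
  ultimately show "piecewise_C1_path M A (\<lambda>t. \<gamma> (1 - t))"
    by (auto simp: piecewise_C1_path_altdef)
  assume g: "continuous_metric A g"
  have "(\<lambda>x::real. x / -1 - 1 / -1) ` {0..1} = {0..1}"
    using image_affinity_atLeastAtMost[of "-1" 1 0 "1::real"] by simp
  from speed_affine_has_integral[OF g \<gamma> _ _ _ _ this]
  show "curve_length A g (\<lambda>t. \<gamma> (1 - t)) = curve_length A g \<gamma>"
    by (simp add: curve_length_eq integral_unique)
qed

lemma join_path:
  assumes \<gamma>: "piecewise_C1_path M A \<gamma>" and \<delta>: "piecewise_C1_path M A \<delta>" and eq: "\<gamma> 1 = \<delta> 0"
  shows "piecewise_C1_path M A (path_join \<gamma> \<delta>)"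
    and "continuous_metric A g \<Longrightarrow>
      curve_length A g (path_join \<gamma> \<delta>) = curve_length A g \<gamma> + curve_length A g \<delta>"
proof -
  obtain S where \<gamma>: "pathin M \<gamma>" "C1_except A \<gamma> S"
    using \<gamma> by (auto simp: piecewise_C1_path_altdef)
  obtain T where \<delta>: "pathin M \<delta>" "C1_except A \<delta> T"
    using \<delta> by (auto simp: piecewise_C1_path_altdef)
  have mid: "\<gamma> (2 * t) = \<delta> (2 * t - 1)" if "t * 2 = 1" for t
    using eq that by (simp add: mult.commute[of 2 t])
  have half: "path_join \<gamma> \<delta> t = \<delta> (2 * t + - 1)" if "t \<ge> 1/2" for t
    using that mid[of t] by (auto simp: path_join_def)
  have "pathin M (path_join \<gamma> \<delta>)"
    unfolding pathin_def path_join_def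
  proof (rule continuous_map_cases_le)
    show "continuous_map (subtopology (top_of_set {0..1}) {x \<in> topspace (top_of_set {0..1}). x \<le> 1/2}) M (\<lambda>t. \<gamma> (2 * t))"
      using pathin_affine[OF \<gamma>(1), of "{0..1} \<inter> {x \<in> {0..1}. x \<le> 1/2}" 2 0] by (auto simp: subtopology_subtopology)
    show "continuous_map (subtopology (top_of_set {0..1}) {x \<in> topspace (top_of_set {0..1}). 1/2 \<le> x}) M (\<lambda>t. \<delta> (2 * t - 1))"
      using pathin_affine[OF \<delta>(1), of "{0..1} \<inter> {x \<in> {0..1}. 1/2 \<le> x}" 2 "-1"] by (auto simp: subtopology_subtopology)
  qed (auto simp: mid)
  \<comment> \<open>The joint 1/2 becomes a break point, as the two one-sided derivatives may differ
    there. An interval whose interior avoids it lies in one half, where the curve is a rescaled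
    piece of \<gamma> or of \<delta>.\<close>
  moreover have "C1_except A (path_join \<gamma> \<delta>) (insert (1/2) ({t. 2 * t + 0 \<in> S} \<union> {t. 2 * t + - 1 \<in> T}))"
    unfolding C1_except_def
  proof (intro conjI allI impI)
    show "finite (insert (1/2) ({t. 2 * t + 0 \<in> S} \<union> {t. 2 * t + - 1 \<in> T}))"
      using finite_affine_vimage[of S 2 0] finite_affine_vimage[of T 2 "-1"] \<gamma>(2) \<delta>(2)
      by (simp add: C1_except_def)
    fix a b :: real
    assume ab: "0 \<le> a \<and> a < b \<and> b \<le> 1 \<and>
      {a<..<b} \<inter> insert (1/2) ({t. 2 * t + 0 \<in> S} \<union> {t. 2 * t + - 1 \<in> T}) = {}"
    then have nS: "t \<notin> {t. 2 * t + 0 \<in> S}" "t \<notin> {t. 2 * t + - 1 \<in> T}" if "t \<in> {a<..<b}" for t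
      using that by blast+
    have "1/2 \<notin> {a<..<b}" using ab by blast
    then consider "b \<le> 1/2" | "1/2 \<le> a" using ab by fastforce
    then show "C1_curve_on A (path_join \<gamma> \<delta>) {a..b}"
    proof cases
      case 1
      have "s \<notin> S" if "s \<in> {2 * a<..<2 * b}" for s using nS(1)[of "s/2"] that by auto
      then have "{2 * a<..<2 * b} \<inter> S = {}" by blast
      then have "C1_curve_on A \<gamma> {2 * a..2 * b}"
        using \<gamma>(2) ab 1 unfolding C1_except_def by auto
      then show ?thesis
        by (rule C1_curve_on_affine[where m = 2 and k = 0]) (use 1 in \<open>auto simp: path_join_def\<close>)
    next
      case 2
      have "s \<notin> T" if "s \<in> {2 * a - 1<..<2 * b - 1}" for s
        using nS(2)[of "(s + 1)/2"] that by (auto simp: field_simps)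
      then have "{2 * a - 1<..<2 * b - 1} \<inter> T = {}" by blast
      then have "C1_curve_on A \<delta> {2 * a - 1..2 * b - 1}"
        using \<delta>(2) ab 2 unfolding C1_except_def by auto
      then show ?thesis
        by (rule C1_curve_on_affine[where m = 2 and k = "-1"]) (use 2 half in auto)
    qed
  qed
  ultimately show "piecewise_C1_path M A (path_join \<gamma> \<delta>)"
    by (auto simp: piecewise_C1_path_altdef)
  assume g: "continuous_metric A g"
  have "(\<lambda>x::real. x / 2 - 0 / 2) ` {0..1} = {0..1/2}"
    using image_affinity_atLeastAtMost_div[of 2 0 0 "1::real"] by simp
  from speed_affine_has_integral[OF g \<gamma> _ _ _ _ this, of "path_join \<gamma> \<delta>"]
  have "(speed A g (path_join \<gamma> \<delta>) has_integral curve_length A g \<gamma>) {0..1/2}"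
    by (simp add: path_join_def)
  moreover have "(\<lambda>x::real. x / 2 - - 1 / 2) ` {0..1} = {1/2..1}"
    using image_affinity_atLeastAtMost_div[of 2 "1/2" 0 "1::real"] by simp
  from speed_affine_has_integral[OF g \<delta> _ _ _ _ this, of "path_join \<gamma> \<delta>"]
  have "(speed A g (path_join \<gamma> \<delta>) has_integral curve_length A g \<delta>) {1/2..1}"
    using half by simp
  ultimately have "(speed A g (path_join \<gamma> \<delta>) has_integral curve_length A g \<gamma> + curve_length A g \<delta>) {0..1}"
    using has_integral_combine[of 0 "1/2" 1] by simp
  then show "curve_length A g (path_join \<gamma> \<delta>) = curve_length A g \<gamma> + curve_length A g \<delta>"
    unfolding curve_length_eq[of A g "path_join \<gamma> \<delta>"] by (rule integral_unique)
qed

section \<open>Coordinate segments and connecting curves\<close>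

text \<open>In any other chart a coordinate segment is a transition map applied to an affine map, so
  it has no break points. Segments join nearby points, and the degenerate one is the constant
  curve.\<close>

lemma line_path:
  assumes c: "c \<in> A" and seg: "\<And>t. t \<in> {0..1} \<Longrightarrow> z + t *\<^sub>R (w - z) \<in> snd c ` fst c"
  shows "piecewise_C1_path M A (\<lambda>t. chart_inv c (z + t *\<^sub>R (w - z)))"
proof -
  let ?l = "\<lambda>t. z + t *\<^sub>R (w - z)"
  have "continuous_map (top_of_set {0..1}) (top_of_set (snd c ` fst c)) ?l"
    using seg by (auto intro!: continuous_intros)
  from continuous_map_compose[OF this chart_inv_continuous_map[OF c]]
  have "pathin M (\<lambda>t. chart_inv c (?l t))" by (simp add: pathin_def o_def)
  moreover have "C1_curve_on A (\<lambda>t. chart_inv c (?l t)) {a..b}" if ab: "0 \<le> a" "b \<le> 1" for a b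
    unfolding C1_curve_on_def Let_def
  proof (intro ballI exI conjI)
    fix d assume d: "d \<in> A"
    define T where "T = {t \<in> {a..b}. chart_inv c (?l t) \<in> fst d}"
    have T: "?l ` T \<subseteq> snd c ` (fst c \<inter> fst d)"
    proof
      fix x assume "x \<in> ?l ` T"
      then obtain t where t: "t \<in> T" "x = ?l t" by blast
      then have "?l t \<in> snd c ` fst c" using seg ab by (auto simp: T_def)
      then have "chart_inv c (?l t) \<in> fst c \<inter> fst d" "x = snd c (chart_inv c (?l t))"
        using t(1) chart_inv_right[of "?l t" c] chart_inv_in[of "?l t" c]
        by (simp_all only: t(2)) (simp add: T_def)
      then show "x \<in> snd c ` (fst c \<inter> fst d)" by blast
    qed
    let ?D = "\<lambda>t. frechet_derivative (snd d \<circ> chart_inv c) (at (?l t)) (w - z)"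
    show "continuous_on {t \<in> {a..b}. chart_inv c (?l t) \<in> fst d} ?D"
      unfolding T_def[symmetric]
      by (rule continuous_on_compose2[OF smooth_on_continuous_derivative[OF transition_smooth[OF c d]] _ T])
         (intro continuous_intros)
    fix t assume "t \<in> {t \<in> {a..b}. chart_inv c (?l t) \<in> fst d}"
    then have t: "t \<in> T" by (simp add: T_def)
    have "(?l has_vector_derivative (w - z)) (at t within T)"
      by (auto intro!: derivative_eq_intros)
    moreover have "((snd d \<circ> chart_inv c) has_derivative
        frechet_derivative (snd d \<circ> chart_inv c) (at (?l t))) (at (?l t) within ?l ` T)"
      using frechet_derivative_has_derivative[OF transition_smooth[OF c d]] T t
      by (blast intro: has_derivative_at_withinI)
    ultimately have "((snd d \<circ> chart_inv c \<circ> ?l) has_vector_derivative ?D t) (at t within T)"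
      by (rule vector_derivative_diff_chain_within)
    then show "((snd d \<circ> (\<lambda>t. chart_inv c (?l t))) has_vector_derivative ?D t)
        (at t within {t \<in> {a..b}. chart_inv c (?l t) \<in> fst d})"
      unfolding T_def[symmetric] by (simp add: o_def)
  qed
  then have "C1_except A (\<lambda>t. chart_inv c (?l t)) {}" by (simp add: C1_except_def)
  ultimately show ?thesis by (auto simp: piecewise_C1_path_altdef)
qed

lemma path_const:
  assumes p: "p \<in> topspace M"
  shows "piecewise_C1_path M A (\<lambda>_. p)"
    and "continuous_metric A g \<Longrightarrow> curve_length A g (\<lambda>_. p) = 0"
proof -
  obtain c where "c \<in> charts_at A p" using chart_exists[OF p] by blast
  then have c: "c \<in> A" "p \<in> fst c" by (auto simp: charts_at_def)
  show \<gamma>: "piecewise_C1_path M A (\<lambda>_. p)"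
    using line_path[OF c(1), of "snd c p" "snd c p"] c by simp
  assume g: "continuous_metric A g"
  obtain G where G: "metric_in_chart A g c G" using g c by (auto simp: continuous_metric_def)
  have "velocity A (\<lambda>_. p) t = (\<lambda>_. 0)" if "t \<in> {0..1}" for t
  proof
    fix d :: "'a chart"
    have "vector_derivative (snd d \<circ> (\<lambda>_. p)) (at t within {0..1}) = 0"
      using that by (intro vector_derivative_within_closed_interval) (auto simp: o_def)
    then show "velocity A (\<lambda>_. p) t d = 0"
      by (simp add: velocity_def)
  qed
  moreover have "g p (\<lambda>_. 0) (\<lambda>_. 0) = 0"
    using continuous_metric_scale[OF g coord_vector_in_tangent_space[of c p 0] p, of 0] c
    by (simp add: charts_at_def)
  ultimately have "((\<lambda>t. sqrt (g p (velocity A (\<lambda>_. p) t) (velocity A (\<lambda>_. p) t))) has_integral 0) {0..1}"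
    by (intro has_integral_is_0) simp
  then show "curve_length A g (\<lambda>_. p) = 0"
    unfolding curve_length_def by (rule integral_unique)
qed

text \<open>Reachability is an equivalence relation with open classes, because a point is joined to
  all points of a coordinate disc around it by segments; so the class of \<open>p\<close> is open
  and closed. This makes the infimum in \<open>riemannian_dist\<close> one over a nonempty
  set.\<close>

lemma piecewise_C1_connected:
  assumes con: "connected_space M" and p: "p \<in> topspace M" and q: "q \<in> topspace M"
  shows "\<exists>\<gamma>. piecewise_C1_path M A \<gamma> \<and> \<gamma> 0 = p \<and> \<gamma> 1 = q"
proof -
  define R where "R = (\<lambda>p q. \<exists>\<gamma>. piecewise_C1_path M A \<gamma> \<and> \<gamma> 0 = p \<and> \<gamma> 1 = q)"
  have sym: "R y x" if "R x y" for x y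
    using that reverse_path(1) unfolding R_def by fastforce
  have trans: "R x z" if xy: "R x y" and yz: "R y z" for x y z
  proof -
    obtain \<gamma> \<delta> where *: "piecewise_C1_path M A \<gamma>" "\<gamma> 0 = x" "\<gamma> 1 = y"
        "piecewise_C1_path M A \<delta>" "\<delta> 0 = y" "\<delta> 1 = z"
      using xy yz unfolding R_def by blast
    then have "piecewise_C1_path M A (path_join \<gamma> \<delta>)" by (intro join_path) auto
    moreover have "path_join \<gamma> \<delta> 0 = x" "path_join \<gamma> \<delta> 1 = z" using * by (auto simp: path_join_def)
    ultimately show ?thesis unfolding R_def by blast
  qed
  have loc: "\<exists>U. openin M U \<and> x \<in> U \<and> (\<forall>y\<in>U. R x y)" if x: "x \<in> topspace M" for x
  proof -
    obtain c where "c \<in> charts_at A x" using chart_exists[OF x] by blast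
    then have c: "c \<in> A" "x \<in> fst c" by (auto simp: charts_at_def)
    then obtain e where e: "e > 0" "ball (snd c x) e \<subseteq> snd c ` fst c"
      using chart_open[OF c(1)] open_contains_ball by (metis imageI)
    define U where "U = {y \<in> fst c. snd c y \<in> ball (snd c x) e}"
    have "openin M U" unfolding U_def by (rule chart_preimage_open[OF c(1)]) simp
    moreover have "x \<in> U" using c e by (simp add: U_def)
    moreover have "R x y" if y: "y \<in> U" for y
    proof -
      have "snd c x + t *\<^sub>R (snd c y - snd c x) \<in> snd c ` fst c" if t: "t \<in> {0..1}" for t
      proof -
        have "(1 - t) *\<^sub>R snd c x + t *\<^sub>R snd c y \<in> ball (snd c x) e"
          by (rule convexD[OF convex_ball]) (use t y e in \<open>auto simp: U_def\<close>)
        then show ?thesis using e(2) by (auto simp: algebra_simps)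
      qed
      from line_path[OF c(1) this] show ?thesis
        unfolding R_def using c y by (intro exI[of _ "\<lambda>t. chart_inv c (snd c x + t *\<^sub>R (snd c y - snd c x))"]) (auto simp: U_def)
    qed
    ultimately show ?thesis by blast
  qed
  define E where "E = {x \<in> topspace M. R p x}"
  have "openin M E"
  proof (subst openin_subopen, rule ballI)
    fix x assume x: "x \<in> E"
    then obtain U where U: "openin M U" "x \<in> U" "\<forall>y\<in>U. R x y" using loc by (auto simp: E_def)
    have "y \<in> E" if "y \<in> U" for y
      using trans[of p x y] x U that openin_subset[OF U(1)] by (auto simp: E_def)
    then have "U \<subseteq> E" by blast
    then show "\<exists>T. openin M T \<and> x \<in> T \<and> T \<subseteq> E" using U by blast
  qed
  moreover have "openin M (topspace M - E)"
  proof (subst openin_subopen, rule ballI)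
    fix x assume x: "x \<in> topspace M - E"
    then obtain U where U: "openin M U" "x \<in> U" "\<forall>y\<in>U. R x y" using loc by auto
    have "y \<in> topspace M - E" if "y \<in> U" for y
      using trans[of p y x] sym[of x y] x U that openin_subset[OF U(1)] by (auto simp: E_def)
    then have "U \<subseteq> topspace M - E" by blast
    then show "\<exists>T. openin M T \<and> x \<in> T \<and> T \<subseteq> topspace M - E" using U by blast
  qed
  moreover have "E \<subseteq> topspace M" by (auto simp: E_def)
  ultimately have "E = {} \<or> E = topspace M"
    using con by (auto simp: connected_space_clopen_in closedin_def)
  moreover have "p \<in> E" using path_const(1)[OF p] p by (auto simp: E_def R_def)
  ultimately show ?thesis using q by (auto simp: E_def R_def)
qed

end

section \<open>The Riemannian distance\<close>

context surface
begin

text \<open>A curve leaving a small coordinate disc is at least as long as its part up to the first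
  exit time; Hausdorffness makes this part reach the boundary circle of the disc.\<close>

lemma curve_length_exit:
  assumes g: "continuous_metric A g" and \<gamma>: "piecewise_C1_path M A \<gamma>"
    and c: "c \<in> A" "\<gamma> 0 \<in> fst c" and G: "metric_in_chart A g c G"
    and e: "e > 0" "cball (snd c (\<gamma> 0)) e \<subseteq> snd c ` fst c"
    and m: "m > 0" "\<And>z v. z \<in> cball (snd c (\<gamma> 0)) e \<Longrightarrow> m\<^sup>2 * (norm v)\<^sup>2 \<le> G z v"
    and exit: "\<gamma> 1 \<notin> {q \<in> fst c. snd c q \<in> ball (snd c (\<gamma> 0)) e}"
  shows "m * e \<le> curve_length A g \<gamma>"
proof -
  obtain S where \<gamma>: "pathin M \<gamma>" "C1_except A \<gamma> S"
    using \<gamma> by (auto simp: piecewise_C1_path_altdef)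
  define z where "z = snd c (\<gamma> 0)"
  define U where "U = {q \<in> fst c. snd c q \<in> ball z e}"
  have U: "openin M U" unfolding U_def by (rule chart_preimage_open[OF c(1)]) simp
  \<comment> \<open>A compact set in a Hausdorff space is closed, so the limit of the curve at the
    exit time is still in the domain of the chart. Otherwise the curve could leave that domain
    without approaching the boundary circle in coordinates.\<close>
  have K: "closedin M (chart_inv c ` cball z e)"
  proof (rule compactin_imp_closedin[OF Hausdorff])
    have "compactin (top_of_set (snd c ` fst c)) (cball z e)"
      using e(2) by (simp add: compactin_subtopology z_def)
    then show "compactin M (chart_inv c ` cball z e)"
      using chart_inv_continuous_map[OF c(1)] image_compactin by blast
  qed
  have path: "continuous_map (top_of_set {0..1}) M \<gamma>" using \<gamma>(1) by (simp add: pathin_def)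
  \<comment> \<open>\<open>B\<close> collects the times outside the open disc; its infimum is the
    first exit time.\<close>
  define B where "B = {t \<in> {0..1}. \<gamma> t \<in> topspace M - U}"
  have "closedin (top_of_set {0..1}) B"
    unfolding B_def using closedin_continuous_map_preimage[OF path, of "topspace M - U"] closedin_diff[OF closedin_topspace U]
    by (simp add: conj_commute)
  then have "closed B" using closedin_closed_trans closed_atLeastAtMost by blast
  have B1: "1 \<in> B" using exit pathin_topspace[OF \<gamma>(1)] by (auto simp: B_def U_def z_def)
  have bdd: "bdd_below B" by (auto simp: B_def bdd_below_def)
  define T where "T = Inf B"
  have TB: "T \<in> B" unfolding T_def using closed_contains_Inf[OF _ bdd \<open>closed B\<close>] B1 by blast
  have "\<gamma> 0 \<in> U" using c e(1) by (simp add: U_def z_def)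
  then have T: "0 < T" "T \<le> 1" using TB by (auto simp: B_def less_le)
  have inU: "\<gamma> t \<in> U" if "t \<in> {0..<T}" for t
  proof (rule ccontr)
    assume "\<gamma> t \<notin> U"
    then have "t \<in> B" using that T pathin_topspace[OF \<gamma>(1), of t] by (auto simp: B_def)
    then show False using cInf_lower[OF _ bdd, of t] that by (simp add: T_def)
  qed
  have "\<gamma> T \<in> chart_inv c ` cball z e"
  proof -
    have "closedin (top_of_set {0..1}) {t \<in> {0..1}. \<gamma> t \<in> chart_inv c ` cball z e}"
      using closedin_continuous_map_preimage[OF path K] by simp
    then have "closed {t \<in> {0..1}. \<gamma> t \<in> chart_inv c ` cball z e}"
      using closedin_closed_trans closed_atLeastAtMost by blast
    moreover have "{0..<T} \<subseteq> {t \<in> {0..1}. \<gamma> t \<in> chart_inv c ` cball z e}"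
    proof
      fix t assume t: "t \<in> {0..<T}"
      then have "\<gamma> t = chart_inv c (snd c (\<gamma> t))" "snd c (\<gamma> t) \<in> cball z e"
        using inU[OF t] c by (auto simp: U_def)
      then show "t \<in> {t \<in> {0..1}. \<gamma> t \<in> chart_inv c ` cball z e}" using t T by auto
    qed
    ultimately have "closure {0..<T} \<subseteq> {t \<in> {0..1}. \<gamma> t \<in> chart_inv c ` cball z e}"
      by (rule closure_minimal[rotated])
    moreover have "T \<in> closure {0..<T}" using T by simp
    ultimately show ?thesis by blast
  qed
  then obtain w where w: "w \<in> cball z e" "\<gamma> T = chart_inv c w" by blast
  then have Tc: "\<gamma> T \<in> fst c" "snd c (\<gamma> T) = w"
    using e(2) chart_inv_in[of w c] chart_inv_right[of w c] by (auto simp: z_def)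
  have "\<gamma> T \<notin> U" using TB by (simp add: B_def)
  then have far: "norm (snd c (\<gamma> T) - z) \<ge> e"
    using Tc by (auto simp: U_def dist_norm norm_minus_commute)
  have inc: "\<gamma> t \<in> fst c" if "t \<in> {0..T}" for t
    using inU[of t] Tc(1) that by (cases "t = T") (auto simp: U_def)
  define x where "x = snd c \<circ> \<gamma>"
  \<comment> \<open>Both \<open>D\<close> and \<phi> are set to 0 at the ends and at the break
    points, so that the bound of \<open>D\<close> by \<phi>/m holds at every time while the
    integrals are unaffected.\<close>
  define D where "D t = (if t \<in> {0<..<T} - S then velocity A \<gamma> t c else 0)" for t
  define \<phi> where "\<phi> t = (if t \<in> {0<..<T} - S then speed A g \<gamma> t else 0)" for t
  have fin: "finite (S \<union> {0, T})" using \<gamma>(2) by (simp add: C1_except_def)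
  have int: "speed A g \<gamma> integrable_on {0..T}"
    using speed_integrable[OF g \<gamma>] T by (rule_tac integrable_on_subinterval) auto
  have int\<phi>: "(\<phi> has_integral integral {0..T} (speed A g \<gamma>)) {0..T}"
    using T by (intro has_integral_spike_finite[OF fin _ integrable_integral[OF int]]) (auto simp: \<phi>_def)
  have contx: "continuous_on {0..T} x"
  proof -
    have "continuous_map (top_of_set {0..T}) (subtopology M (fst c)) \<gamma>"
      using continuous_map_from_subtopology_mono[OF path, of "{0..T}"] T inc
      by (auto simp: continuous_map_in_subtopology)
    from continuous_map_compose[OF this chart_continuous_map[OF c(1)]] show ?thesis
      by (simp add: x_def)
  qed
  have "finite S" using \<gamma>(2) by (simp add: C1_except_def)
  \<comment> \<open>The coordinate curve is continuous throughout, so the fundamental theorem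
    tolerates finitely many interior points without a derivative.\<close>
  then have intD: "(D has_integral (x T - x 0)) {0..T}"
  proof (rule fundamental_theorem_of_calculus_interior_strong[OF _ _ _ contx])
    fix t assume t: "t \<in> {0<..<T} - S"
    then have "c \<in> charts_at A (\<gamma> t)" using inc[of t] c by (auto simp: charts_at_def)
    then show "(x has_vector_derivative D t) (at t)"
      unfolding x_def using velocity_derivative[OF \<gamma>, of t c] t T by (auto simp: D_def)
  qed (use T in simp)
  have le: "norm (D t) \<le> \<phi> t / m" for t
  proof (cases "t \<in> {0<..<T} - S")
    case True
    then have t: "t \<in> {0<..<1} - S" using T by auto
    have "\<gamma> t \<in> U" using inU[of t] True by auto
    then have ct: "c \<in> charts_at A (\<gamma> t)" "snd c (\<gamma> t) \<in> cball z e"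
      using c by (auto simp: U_def charts_at_def)
    have "m * norm (D t) = sqrt (m\<^sup>2 * (norm (velocity A \<gamma> t c))\<^sup>2)"
      using True m(1) by (simp add: D_def real_sqrt_mult)
    also have "\<dots> \<le> speed A g \<gamma> t"
      unfolding speed_in_chart[OF \<gamma> t ct(1) G] using m(2) ct(2) by (simp add: z_def)
    finally show ?thesis using True m(1) by (simp add: \<phi>_def field_simps)
  qed (auto simp: D_def \<phi>_def)
  have "norm (x T - x 0) \<le> integral {0..T} (speed A g \<gamma>) / m"
    using integral_norm_bound_integral[of D "{0..T}" "\<lambda>t. \<phi> t / m"] le
      has_integral_divide[OF int\<phi>, of m] intD
    by (metis has_integral_integrable integral_unique)
  moreover have "norm (x T - x 0) \<ge> e" using far by (simp add: x_def z_def)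
  ultimately have "m * e \<le> integral {0..T} (speed A g \<gamma>)"
    using m(1) by (smt (verit) mult.commute pos_le_divide_eq)
  also have "\<dots> \<le> curve_length A g \<gamma>"
  proof -
    have int01: "speed A g \<gamma> integrable_on {T..1}"
      using speed_integrable[OF g \<gamma>] T by (rule_tac integrable_on_subinterval) auto
    have "finite (S \<union> {T, 1})" using \<gamma>(2) by (simp add: C1_except_def)
    then have "((\<lambda>t. if t \<in> {T<..<1} - S then speed A g \<gamma> t else 0) has_integral
        integral {T..1} (speed A g \<gamma>)) {T..1}"
      by (rule has_integral_spike_finite[OF _ _ integrable_integral[OF int01]]) (use T in auto)
    then have "integral {T..1} (speed A g \<gamma>) \<ge> 0"
      by (rule has_integral_nonneg) (use speed_nonneg[OF g \<gamma>] T in auto)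
    moreover have "integral {0..T} (speed A g \<gamma>) + integral {T..1} (speed A g \<gamma>) = curve_length A g \<gamma>"
      using Henstock_Kurzweil_Integration.integral_combine[OF _ _ speed_integrable[OF g \<gamma>], of T] T by (simp add: curve_length_eq)
    ultimately show ?thesis by simp
  qed
  finally show ?thesis .
qed

text \<open>By compactness \<open>G\<close> attains a positive minimum on \<open>K\<close> times the
  unit circle; homogeneity carries the bound from unit vectors to all vectors, and m is the square
  root of the minimum.\<close>

lemma metric_lower_bound:
  assumes G: "metric_in_chart A g c G" and K: "compact K" "K \<subseteq> snd c ` fst c"
  shows "\<exists>m>0. \<forall>z\<in>K. \<forall>v. m\<^sup>2 * (norm v)\<^sup>2 \<le> G z v"
proof (cases "K = {}")
  case True
  then show ?thesis by (auto intro: exI[of _ 1])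
next
  case False
  have G': "continuous_on (snd c ` fst c \<times> UNIV) (\<lambda>(z, v). G z v)"
    "\<And>z v r. z \<in> K \<Longrightarrow> G z (r *\<^sub>R v) = r\<^sup>2 * G z v"
    "\<And>z v. z \<in> K \<Longrightarrow> v \<noteq> 0 \<Longrightarrow> G z v > 0"
    using G K(2) unfolding metric_in_chart_def by blast+
  have "compact (K \<times> sphere (0::complex) 1)" using K(1) by (intro compact_Times) auto
  moreover have "K \<times> sphere (0::complex) 1 \<noteq> {}"
  proof -
    have "(1::complex) \<in> sphere 0 1" by simp
    then show ?thesis using False by blast
  qed
  moreover have "continuous_on (K \<times> sphere (0::complex) 1) (\<lambda>(z, v). G z v)"
    by (rule continuous_on_subset[OF G'(1)]) (use K in auto)
  ultimately obtain y where y: "y \<in> K \<times> sphere (0::complex) 1"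
    "\<And>x. x \<in> K \<times> sphere (0::complex) 1 \<Longrightarrow> (\<lambda>(z, v). G z v) y \<le> (\<lambda>(z, v). G z v) x"
    using continuous_attains_inf by metis
  define b where "b = G (fst y) (snd y)"
  have "snd y \<noteq> 0" using y(1) by auto
  then have "b > 0" unfolding b_def using y(1) by (intro G'(3)) auto
  have "(sqrt b)\<^sup>2 * (norm v)\<^sup>2 \<le> G z v" if z: "z \<in> K" for z v
  proof (cases "v = 0")
    case True
    then show ?thesis using G'(2)[OF z, of 0 0] by simp
  next
    case False
    define w where "w = v /\<^sub>R norm v"
    have "(z, w) \<in> K \<times> sphere 0 1" using z False by (simp add: w_def)
    from y(2)[OF this] have "b \<le> G z w" by (simp add: b_def case_prod_unfold)
    moreover have "G z v = (norm v)\<^sup>2 * G z w"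
      using G'(2)[OF z, of "norm v" w] False by (simp add: w_def)
    ultimately show ?thesis using \<open>b > 0\<close> by (simp add: mult.commute mult_right_mono)
  qed
  then show ?thesis using \<open>b > 0\<close> by (intro exI[of _ "sqrt b"]) auto
qed

section \<open>The distance axioms\<close>

lemma riemannian_dist_le:
  assumes g: "continuous_metric A g" and \<gamma>: "piecewise_C1_path M A \<gamma>"
  shows "riemannian_dist M A g (\<gamma> 0) (\<gamma> 1) \<le> curve_length A g \<gamma>"
proof -
  have "\<gamma> 0 \<in> topspace M" "\<gamma> 1 \<in> topspace M"
    using \<gamma> by (auto simp: piecewise_C1_path_def intro: pathin_topspace)
  moreover have "bdd_below {curve_length A g \<delta> |\<delta>. piecewise_C1_path M A \<delta> \<and> \<delta> 0 = \<gamma> 0 \<and> \<delta> 1 = \<gamma> 1}"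
    by (rule bdd_belowI[of _ 0]) (use curve_length_nonneg[OF g] in auto)
  ultimately show ?thesis
    using \<gamma> by (auto simp: riemannian_dist_def intro!: cInf_lower)
qed

text \<open>Together with \<open>riemannian_dist_le\<close> this is the interface to the infimum:
  lower bounds on the distance come from bounds valid for all connecting curves, upper bounds from a
  single curve.\<close>

lemma riemannian_dist_greatest:
  assumes con: "connected_space M" and pq: "p \<in> topspace M" "q \<in> topspace M"
    and le: "\<And>\<gamma>. piecewise_C1_path M A \<gamma> \<Longrightarrow> \<gamma> 0 = p \<Longrightarrow> \<gamma> 1 = q \<Longrightarrow> b \<le> curve_length A g \<gamma>"
  shows "b \<le> riemannian_dist M A g p q"
proof -
  have "b \<le> Inf {curve_length A g \<gamma> |\<gamma>. piecewise_C1_path M A \<gamma> \<and> \<gamma> 0 = p \<and> \<gamma> 1 = q}"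
    by (rule cInf_greatest) (use piecewise_C1_connected[OF con pq] le in auto)
  then show ?thesis using pq by (simp add: riemannian_dist_def)
qed

text \<open>A small enough coordinate disc around \<open>p\<close> misses \<open>q\<close>, so every
  curve from \<open>p\<close> to \<open>q\<close> has to leave it, at a cost of at least
  \<open>m * e\<close>.\<close>

lemma riemannian_dist_pos:
  assumes con: "connected_space M" and g: "continuous_metric A g"
    and pq: "p \<in> topspace M" "q \<in> topspace M" "p \<noteq> q"
  shows "riemannian_dist M A g p q > 0"
proof -
  obtain c where "c \<in> charts_at A p" using chart_exists[OF pq(1)] by blast
  then have c: "c \<in> A" "p \<in> fst c" by (auto simp: charts_at_def)
  then obtain r where r: "r > 0" "cball (snd c p) r \<subseteq> snd c ` fst c"
    using chart_open[OF c(1)] open_contains_cball by (metis imageI)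
  \<comment> \<open>If \<open>q\<close> has a coordinate in the chart, the radius is at most its
    coordinate distance from \<open>p\<close>, positive because charts are injective; otherwise any
    radius does.\<close>
  obtain e where e: "e > 0" "e \<le> r" "q \<notin> {q \<in> fst c. snd c q \<in> ball (snd c p) e}"
  proof (cases "q \<in> fst c")
    case True
    then have "snd c q \<noteq> snd c p" using chart_inj[OF c(1)] c pq by (auto simp: inj_on_def)
    then show thesis using r by (intro that[of "min r (dist (snd c p) (snd c q))"]) auto
  next
    case False
    then show thesis using r by (intro that[of r]) auto
  qed
  have sub: "cball (snd c p) e \<subseteq> snd c ` fst c" using r e by (auto simp: subset_iff)
  obtain G where G: "metric_in_chart A g c G" using g c by (auto simp: continuous_metric_def)
  obtain m where m: "m > 0" "\<forall>z\<in>cball (snd c p) e. \<forall>v. m\<^sup>2 * (norm v)\<^sup>2 \<le> G z v"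
    using metric_lower_bound[OF G compact_cball sub] by blast
  have "m * e \<le> riemannian_dist M A g p q"
  proof (rule riemannian_dist_greatest[OF con pq(1,2)])
    fix \<gamma> assume "piecewise_C1_path M A \<gamma>" "\<gamma> 0 = p" "\<gamma> 1 = q"
    then show "m * e \<le> curve_length A g \<gamma>"
      using c G e m sub by (intro curve_length_exit[OF g _ _ _ G]) auto
  qed
  then show ?thesis using m e by (smt (verit) mult_pos_pos)
qed

theorem Metric_space_riemannian_dist:
  assumes con: "connected_space M" and g: "continuous_metric A g"
  shows "Metric_space (topspace M) (riemannian_dist M A g)"
proof
  let ?d = "riemannian_dist M A g"
  fix p q
  show "0 \<le> ?d p q"
  proof (cases "p \<in> topspace M \<and> q \<in> topspace M")
    case True
    then show ?thesis using curve_length_nonneg[OF g] by (auto intro!: riemannian_dist_greatest[OF con])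
  qed (auto simp: riemannian_dist_def)
  have le: "?d q p \<le> ?d p q" if "p \<in> topspace M" "q \<in> topspace M" for p q
  proof (rule riemannian_dist_greatest[OF con that])
    fix \<gamma> assume \<gamma>: "piecewise_C1_path M A \<gamma>" "\<gamma> 0 = p" "\<gamma> 1 = q"
    then show "?d q p \<le> curve_length A g \<gamma>"
      using riemannian_dist_le[OF g reverse_path(1)[OF \<gamma>(1)]] reverse_path(2)[OF \<gamma>(1) g] by simp
  qed
  show "?d p q = ?d q p"
  proof (cases "p \<in> topspace M \<and> q \<in> topspace M")
    case True
    then show ?thesis using le by (meson order_antisym)
  qed (auto simp: riemannian_dist_def)
  assume pq: "p \<in> topspace M" "q \<in> topspace M"
  show "?d p q = 0 \<longleftrightarrow> p = q"
  proof
    assume "p = q"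
    then have "?d p q \<le> 0"
      using riemannian_dist_le[OF g path_const(1)[OF pq(1)]] path_const(2)[OF pq(1) g] by simp
    moreover have "?d p q \<ge> 0"
      using curve_length_nonneg[OF g] pq by (auto intro!: riemannian_dist_greatest[OF con])
    ultimately show "?d p q = 0" by simp
  next
    assume "?d p q = 0"
    then show "p = q" using riemannian_dist_pos[OF con g pq] by force
  qed
next
  let ?d = "riemannian_dist M A g"
  fix p q s assume pqs: "p \<in> topspace M" "q \<in> topspace M" "s \<in> topspace M"
  \<comment> \<open>The triangle inequality is rearranged so that each infimum is bounded from below
    in turn, first over \<gamma> and then over \<delta>; no almost minimising curves have to be
    chosen.\<close>
  have "?d p s - ?d q s \<le> ?d p q"
  proof (rule riemannian_dist_greatest[OF con pqs(1,2)])
    fix \<gamma> assume \<gamma>: "piecewise_C1_path M A \<gamma>" "\<gamma> 0 = p" "\<gamma> 1 = q"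
    have "?d p s - curve_length A g \<gamma> \<le> ?d q s"
    proof (rule riemannian_dist_greatest[OF con pqs(2,3)])
      fix \<delta> assume \<delta>: "piecewise_C1_path M A \<delta>" "\<delta> 0 = q" "\<delta> 1 = s"
      have eq: "\<gamma> 1 = \<delta> 0" using \<gamma> \<delta> by simp
      have "path_join \<gamma> \<delta> 0 = p" "path_join \<gamma> \<delta> 1 = s" using \<gamma> \<delta> by (auto simp: path_join_def)
      then show "?d p s - curve_length A g \<gamma> \<le> curve_length A g \<delta>"
        using riemannian_dist_le[OF g join_path(1)[OF \<gamma>(1) \<delta>(1) eq]] join_path(2)[OF \<gamma>(1) \<delta>(1) eq g]
        by simp
    qed
    then show "?d p s - ?d q s \<le> curve_length A g \<gamma>" by simp
  qed
  then show "?d p s \<le> ?d p q + ?d q s" by simp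
qed

section \<open>Comparison of distances and transfer of completeness\<close>

lemma riemannian_dist_mono:
  assumes con: "connected_space M" and g: "continuous_metric A g" and h: "continuous_metric A h"
    and C: "C > 0"
    and le: "\<And>p X. p \<in> topspace M \<Longrightarrow> X \<in> tangent_space A p \<Longrightarrow> g p X X \<le> C\<^sup>2 * h p X X"
  shows "riemannian_dist M A g p q \<le> C * riemannian_dist M A h p q"
proof (cases "p \<in> topspace M \<and> q \<in> topspace M")
  case True
  have "riemannian_dist M A g p q / C \<le> riemannian_dist M A h p q"
  proof (rule riemannian_dist_greatest[OF con])
    fix \<gamma> assume \<gamma>: "piecewise_C1_path M A \<gamma>" "\<gamma> 0 = p" "\<gamma> 1 = q"
    have "riemannian_dist M A g p q \<le> curve_length A g \<gamma>"
      using riemannian_dist_le[OF g \<gamma>(1)] \<gamma> by simp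
    also have "\<dots> \<le> C * curve_length A h \<gamma>"
      by (rule curve_length_le[OF g h less_imp_le[OF C] le \<gamma>(1)])
    finally show "riemannian_dist M A g p q / C \<le> curve_length A h \<gamma>"
      using C by (simp add: field_simps)
  qed (use True in auto)
  then show ?thesis using C by (simp add: field_simps)
qed (auto simp: riemannian_dist_def)

end

text \<open>The first inequality turns Cauchy sequences for \<open>d'\<close> into Cauchy sequences
  for \<open>d\<close>; the second turns their limits for \<open>d\<close> into limits for
  \<open>d'\<close>.\<close>

lemma mcomplete_bilipschitz:
  assumes d: "Metric_space S d" and d': "Metric_space S d'"
    and le: "\<And>x y. d x y \<le> C * d' x y" "\<And>x y. d' x y \<le> C' * d x y" and C: "C > 0" "C' > 0"
    and complete: "Metric_space.mcomplete S d"
  shows "Metric_space.mcomplete S d'"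
proof -
  interpret d: Metric_space S d by fact
  interpret d': Metric_space S d' by fact
  show ?thesis
    unfolding d'.mcomplete_def
  proof (intro allI impI)
    fix s assume s: "d'.MCauchy s"
    have "d.MCauchy s"
      unfolding d.MCauchy_def
    proof (intro conjI allI impI)
      show "range s \<subseteq> S" using s by (simp add: d'.MCauchy_def)
      fix e :: real assume "e > 0"
      then have "e / C > 0" using C by simp
      then obtain N where "\<And>n n'. N \<le> n \<Longrightarrow> N \<le> n' \<Longrightarrow> d' (s n) (s n') < e / C"
        using s unfolding d'.MCauchy_def by blast
      then have "d (s n) (s n') < e" if "N \<le> n" "N \<le> n'" for n n'
        using le(1)[of "s n" "s n'"] that C by (smt (verit) mult.commute pos_less_divide_eq)
      then show "\<exists>N. \<forall>n n'. N \<le> n \<longrightarrow> N \<le> n' \<longrightarrow> d (s n) (s n') < e" by blast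
    qed
    then obtain x where x: "limitin d.mtopology s x sequentially"
      using complete d.mcomplete_def by blast
    have "limitin d'.mtopology s x sequentially"
      unfolding d'.limit_metric_sequentially
    proof (intro conjI allI impI)
      show "x \<in> S" using x by (simp add: d.limit_metric_sequentially)
      fix e :: real assume "e > 0"
      then have "e / C' > 0" using C by simp
      then obtain N where "\<And>n. N \<le> n \<Longrightarrow> s n \<in> S \<and> d (s n) x < e / C'"
        using x unfolding d.limit_metric_sequentially by blast
      then have "s n \<in> S \<and> d' (s n) x < e" if "N \<le> n" for n
        using le(2)[of "s n" x] that C by (smt (verit) mult.commute pos_less_divide_eq)
      then show "\<exists>N. \<forall>n\<ge>N. s n \<in> S \<and> d' (s n) x < e" by blast
    qed
    then show "\<exists>x. limitin d'.mtopology s x sequentially" by blast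
  qed
qed

theorem (in surface) complete_metric_bilipschitz:
  assumes "connected_space M" "continuous_metric A g" "continuous_metric A h"
    and C: "C > 0" "C' > 0"
    and "\<And>p X. p \<in> topspace M \<Longrightarrow> X \<in> tangent_space A p \<Longrightarrow> g p X X \<le> C\<^sup>2 * h p X X"
    and "\<And>p X. p \<in> topspace M \<Longrightarrow> X \<in> tangent_space A p \<Longrightarrow> h p X X \<le> C'\<^sup>2 * g p X X"
  shows "complete_metric M A g \<longleftrightarrow> complete_metric M A h"
proof -
  note ms = Metric_space_riemannian_dist[OF assms(1,2)] Metric_space_riemannian_dist[OF assms(1,3)]
  note le = riemannian_dist_mono[OF assms(1-3) C(1) assms(6)]
    riemannian_dist_mono[OF assms(1,3,2) C(2) assms(7)]
  show ?thesis
    unfolding complete_metric_def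
    using mcomplete_bilipschitz[OF ms le C] mcomplete_bilipschitz[OF ms(2,1) le(2,1) C(2,1)]
    by blast
qed

section \<open>The fundamental forms\<close>

lemma bounded_bilinear_minkowski: "bounded_bilinear (minkowski :: real^4 \<Rightarrow> real^4 \<Rightarrow> real)"
  unfolding bilinear_conv_bounded_bilinear[symmetric] bilinear_def
  by (auto intro!: linearI simp: minkowski_def algebra_simps)

lemmas minkowski_simps =
  bounded_bilinear.add_left[OF bounded_bilinear_minkowski]
  bounded_bilinear.add_right[OF bounded_bilinear_minkowski]
  bounded_bilinear.diff_left[OF bounded_bilinear_minkowski]
  bounded_bilinear.diff_right[OF bounded_bilinear_minkowski]
  bounded_bilinear.scaleR_left[OF bounded_bilinear_minkowski]
  bounded_bilinear.scaleR_right[OF bounded_bilinear_minkowski]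

lemma minkowski_commute: "minkowski x y = minkowski y x"
  by (simp add: minkowski_def mult.commute)

text \<open>Flipping the sign of the time coordinate turns the Minkowski product into the Euclidean
  one, so that products with the rows of a matrix become a matrix-vector product.\<close>

lemma minkowski_inner:
  fixes x y :: "real^4"
  shows "minkowski x y = x \<bullet> (\<chi> i. if i = 0 then - (y $ 0) else y $ i)"
proof -
  \<comment> \<open>\<open>sum_4\<close> runs over the indices 1, 2, 3, 4, and the last of these is
    the time index 0.\<close>
  have "(4::4) = 0" by simp
  show ?thesis by (simp add: minkowski_def inner_vec_def sum_4 \<open>(4::4) = 0\<close>)
qed

text \<open>Orthogonality to the four rows says that the matrix annihilates \<open>w\<close> with
  its time coordinate negated. This lets a vector of R^4 be identified by its products with the
  frame.\<close>

lemma minkowski_frame_nondegenerate: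
  fixes f a b n w :: "real^4"
  assumes "det ((\<chi> i. if i = 0 then f else if i = 1 then a else if i = 2 then b else n) :: real^4^4) \<noteq> 0"
    and w: "minkowski f w = 0" "minkowski a w = 0" "minkowski b w = 0" "minkowski n w = 0"
  shows "w = 0"
proof -
  let ?B = "(\<chi> i. if i = 0 then f else if i = 1 then a else if i = 2 then b else n) :: real^4^4"
  let ?w = "(\<chi> i. if i = 0 then - (w $ 0) else w $ i) :: real^4"
  have "?B *v ?w = 0"
    using w unfolding vec_eq_iff matrix_vector_mul_component by (simp add: minkowski_inner)
  moreover have "\<exists>C. C ** ?B = mat 1"
    using assms(1) unfolding invertible_det_nz[symmetric] invertible_def by blast
  ultimately have "?w = 0" unfolding matrix_left_invertible_ker by blast
  then show ?thesis by (simp add: vec_eq_iff) (metis neg_equal_0_iff_equal)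
qed

text \<open>In a conformal coordinate, \<open>III = II I\<^sup>-\<^sup>1 II\<close> reads \<open>III = \<sigma>\<^sup>2 adj I\<close>.\<close>

lemma third_form_conformal:
  fixes f a b n v :: "real^4" and E F G d s x y :: real
  assumes det: "det ((\<chi> i. if i = 0 then f else if i = 1 then a else if i = 2 then b else n) :: real^4^4) \<noteq> 0"
    and orth: "minkowski f a = 0" "minkowski f b = 0" "minkowski n a = 0" "minkowski n b = 0"
    and I: "minkowski a a = E" "minkowski a b = F" "minkowski b b = G" "E * G - F\<^sup>2 = d\<^sup>2" "d \<noteq> 0"
    and v: "minkowski f v = 0" "minkowski n v = 0" "minkowski a v = - (s * d * x)" "minkowski b v = - (s * d * y)"
  shows "minkowski v v = s\<^sup>2 * (G * x\<^sup>2 - 2 * F * x * y + E * y\<^sup>2)"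
proof -
  \<comment> \<open>The coefficients of \<open>v\<close> with respect to \<open>a\<close> and
    \<open>b\<close>, by Cramer's rule for the system with matrix E, F, F, G and right-hand side
    -sdx, -sdy. The determinant is d^2, and one factor d cancels.\<close>
  define p where "p = - (s / d) * (G * x - F * y)"
  define q where "q = - (s / d) * (E * y - F * x)"
  have ba: "minkowski b a = F" using I(2) by (simp add: minkowski_commute)
  have "p * E + q * F = - (s / d) * ((E * G - F\<^sup>2) * x)"
    by (simp add: p_def q_def algebra_simps power2_eq_square)
  also have "\<dots> = - (s * d * x)" using I(4,5) by (simp add: power2_eq_square)
  finally have 1: "p * E + q * F = - (s * d * x)" .
  have "p * F + q * G = - (s / d) * ((E * G - F\<^sup>2) * y)"
    by (simp add: p_def q_def algebra_simps power2_eq_square)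
  also have "\<dots> = - (s * d * y)" using I(4,5) by (simp add: power2_eq_square)
  finally have 2: "p * F + q * G = - (s * d * y)" .
  \<comment> \<open>The difference is orthogonal to \<open>f\<close> and \<open>n\<close> because
    all of \<open>v\<close>, \<open>a\<close>, \<open>b\<close> are, and to \<open>a\<close> and
    \<open>b\<close> by the choice of \<open>p\<close> and \<open>q\<close>.\<close>
  have "v - (p *\<^sub>R a + q *\<^sub>R b) = 0"
    by (rule minkowski_frame_nondegenerate[OF det]) (use 1 2 in \<open>simp_all add: minkowski_simps orth I v ba\<close>)
  then have "v = p *\<^sub>R a + q *\<^sub>R b" by simp
  then have "minkowski v v = minkowski (p *\<^sub>R a + q *\<^sub>R b) v" by simp
  also have "\<dots> = p * - (s * d * x) + q * - (s * d * y)" by (simp add: minkowski_simps v)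
  also have "\<dots> = s\<^sup>2 * (G * x\<^sup>2 - 2 * F * x * y + E * y\<^sup>2)"
    using I(5) by (simp add: p_def q_def field_simps power2_eq_square)
  finally show ?thesis .
qed

context surface
begin

lemma tangent_eq_zero:
  assumes X: "X \<in> tangent_space A p" and c: "c \<in> charts_at A p" and "X c = 0"
  shows "X = (\<lambda>_. 0)"
proof
  fix d
  show "X d = 0"
  proof (cases "d \<in> charts_at A p")
    case True
    then have "X d = frechet_derivative (snd d \<circ> chart_inv c) (at (snd c p)) (X c)"
      using X c unfolding tangent_space_def by blast
    then show ?thesis
      using has_derivative_linear[OF transition_has_derivative[OF c True]] assms(3) by (simp add: linear_0)
  next
    case False
    then show ?thesis using X unfolding tangent_space_def by blast
  qed
qed

text \<open>The product rule for a constant product. Applied to the pairs (f,f), (n,n) and (n,f),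
  and using that n is normal to df, it shows that df is orthogonal to f and that dn is orthogonal to
  n and to f.\<close>

lemma minkowski_differential_const:
  fixes h k :: "'a \<Rightarrow> real^4"
  assumes h: "smooth_map A h" and k: "smooth_map A k"
    and C: "\<And>p. p \<in> topspace M \<Longrightarrow> minkowski (h p) (k p) = C"
    and p: "p \<in> topspace M" and X: "X \<in> tangent_space A p"
  shows "minkowski (h p) (differential A k p X) + minkowski (differential A h p X) (k p) = 0"
proof -
  obtain c where c: "c \<in> charts_at A p" using chart_exists[OF p] by blast
  then have cA: "c \<in> A" "p \<in> fst c" by (auto simp: charts_at_def)
  note D = bounded_bilinear.FDERIV[OF bounded_bilinear_minkowski
      smooth_map_has_derivative[OF h c] smooth_map_has_derivative[OF k c]]
  have "((\<lambda>_. C) has_derivative (\<lambda>v. minkowski ((h \<circ> chart_inv c) (snd c p)) (frechet_derivative (k \<circ> chart_inv c) (at (snd c p)) v)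
      + minkowski (frechet_derivative (h \<circ> chart_inv c) (at (snd c p)) v) ((k \<circ> chart_inv c) (snd c p)))) (at (snd c p))"
    by (rule has_derivative_transform_within_open[OF D chart_open[OF cA(1)]])
       (use cA C chart_subset[OF cA(1)] in auto)
  from has_derivative_unique[OF this has_derivative_const]
  have "minkowski ((h \<circ> chart_inv c) (snd c p)) (frechet_derivative (k \<circ> chart_inv c) (at (snd c p)) (X c))
      + minkowski (frechet_derivative (h \<circ> chart_inv c) (at (snd c p)) (X c)) ((k \<circ> chart_inv c) (snd c p)) = 0"
    by metis
  then show ?thesis
    using cA by (simp add: differential_chart[OF h c X] differential_chart[OF k c X])
qed

text \<open>The three terms are I, III and -II, and a combination with constant coefficients is
  continuous because df and dn are. Positivity passes to the chart since every component
  \<open>v\<close> is realised by a coordinate vector.\<close>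

lemma continuous_metricI:
  fixes f n :: "'a \<Rightarrow> real^4" and r s t :: real
  assumes f: "smooth_map A f" and n: "smooth_map A n"
    and g: "\<And>p X. p \<in> topspace M \<Longrightarrow> X \<in> tangent_space A p \<Longrightarrow>
      g p X X = r * minkowski (differential A f p X) (differential A f p X)
        + s * minkowski (differential A n p X) (differential A n p X)
        + t * minkowski (differential A f p X) (differential A n p X)"
    and pos: "\<And>p X. p \<in> topspace M \<Longrightarrow> X \<in> tangent_space A p \<Longrightarrow> X \<noteq> (\<lambda>_. 0) \<Longrightarrow> g p X X > 0"
  shows "continuous_metric A g"
  unfolding continuous_metric_def
proof
  fix c assume c: "c \<in> A"
  define F where "F = (\<lambda>z. frechet_derivative (f \<circ> chart_inv c) (at z))"
  define N where "N = (\<lambda>z. frechet_derivative (n \<circ> chart_inv c) (at z))"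
  define G where "G z v = r * minkowski (F z v) (F z v) + s * minkowski (N z v) (N z v)
    + t * minkowski (F z v) (N z v)" for z v
  have at: "c \<in> charts_at A p" "p \<in> topspace M" if "p \<in> fst c" for p
    using that c chart_subset[OF c] by (auto simp: charts_at_def)
  have eq: "g p X X = G (snd c p) (X c)" if "p \<in> fst c" "X \<in> tangent_space A p" for p X
    using g[OF at(2)[OF that(1)] that(2)] differential_chart[OF f at(1)[OF that(1)] that(2)]
      differential_chart[OF n at(1)[OF that(1)] that(2)]
    by (simp add: G_def F_def N_def)
  have contF: "continuous_on (snd c ` fst c \<times> UNIV) (\<lambda>x. F (fst x) (snd x))"
    using smooth_on_continuous_derivative_joint[of "snd c ` fst c" "f \<circ> chart_inv c"] f c
    by (simp add: smooth_map_def F_def case_prod_unfold)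
  have contN: "continuous_on (snd c ` fst c \<times> UNIV) (\<lambda>x. N (fst x) (snd x))"
    using smooth_on_continuous_derivative_joint[of "snd c ` fst c" "n \<circ> chart_inv c"] n c
    by (simp add: smooth_map_def N_def case_prod_unfold)
  have cont: "continuous_on (snd c ` fst c \<times> UNIV) (\<lambda>(z, v). G z v)"
    unfolding G_def case_prod_unfold
    by (intro continuous_intros bounded_bilinear.continuous_on[OF bounded_bilinear_minkowski] contF contN)
  have scale: "G z (l *\<^sub>R v) = l\<^sup>2 * G z v" if "z \<in> snd c ` fst c" for z v l
  proof -
    obtain p where p: "p \<in> fst c" "z = snd c p" using \<open>z \<in> _\<close> by blast
    have "linear (F z)" "linear (N z)"
      unfolding F_def N_def p(2)
      using has_derivative_linear[OF smooth_map_has_derivative[OF f at(1)[OF p(1)]]]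
        has_derivative_linear[OF smooth_map_has_derivative[OF n at(1)[OF p(1)]]] by blast+
    then show ?thesis
      by (simp add: G_def linear_scale minkowski_simps power2_eq_square algebra_simps)
  qed
  have "G z v > 0" if z: "z \<in> snd c ` fst c" and v: "v \<noteq> 0" for z v
  proof -
    obtain p where p: "p \<in> fst c" "z = snd c p" using z by blast
    let ?X = "coord_vector A c p v"
    have X: "?X c = v" "?X \<in> tangent_space A p"
      using at(1)[OF p(1)] coord_vector_in_tangent_space by auto
    then have "?X \<noteq> (\<lambda>_. 0)" using v by metis
    then show ?thesis using eq[OF p(1) X(2)] pos[OF at(2)[OF p(1)] X(2)] X(1) p(2) by simp
  qed
  then show "\<exists>G. metric_in_chart A g c G"
    unfolding metric_in_chart_def using cont scale eq by blast
qed

end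

section \<open>The weak metric and ds^2 at a point, in conformal coordinates\<close>

locale conformal_hyperbolic_surface =
  fixes M :: "'a topology" and A :: "'a chart set" and f n :: "'a \<Rightarrow> real^4" and \<sigma> :: real and ds :: "'a form"
  assumes hyp: "hyperbolic_surface M A f n"
    and curvature: "\<And>p. p \<in> topspace M \<Longrightarrow> gauss_curvature A f n p = -1 + \<sigma>\<^sup>2"
    and \<sigma>: "\<sigma> > 0"
    and ds: "eu_metric M A f n \<sigma> ds"
begin

sublocale surface M A
  using hyp by unfold_locales (simp add: hyperbolic_surface_def)

lemma f_smooth: "smooth_map A f" and n_smooth: "smooth_map A n"
  using hyp by (auto simp: hyperbolic_surface_def)

lemma weak_metric_eq:
  assumes "p \<in> topspace M"
  shows "weak_metric A f n p X X = minkowski (differential A f p X) (differential A f p X)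
    + 1 / \<sigma>\<^sup>2 * minkowski (differential A n p X) (differential A n p X)"
  using curvature[OF assms] by (simp add: weak_metric_def)

text \<open>I has the matrix entries w + 2 Re Q, -2 Im Q, w - 2 Re Q, and III/\<sigma>^2 is its
  adjugate, so in the sum the contributions of Q outside w cancel. The \<open>u\<close> and
  \<open>Q\<close> obtained here are the numbers at \<open>p\<close>.\<close>

lemma forms_conformal:
  assumes p: "p \<in> topspace M"
  obtains c u Q where "c \<in> charts_at A p" "(cmod Q)\<^sup>2 < exp (2 * u)"
    and "\<And>X. X \<in> tangent_space A p \<Longrightarrow>
      weak_metric A f n p X X = 2 * (exp u + (cmod Q)\<^sup>2 * exp (- u)) * (cmod (X c))\<^sup>2"
    and "\<And>X. X \<in> tangent_space A p \<Longrightarrow>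
      fundII A f n p X X = \<sigma> * (exp u - (cmod Q)\<^sup>2 * exp (- u)) * (cmod (X c))\<^sup>2"
    and "\<And>X. X \<in> tangent_space A p \<Longrightarrow> ds p X X = exp u * (cmod (X c))\<^sup>2"
proof -
  obtain c u' where cu: "p \<in> fst c" "conformal_coordinate A f n c"
      "fundamental_expressions A f n \<sigma> c u'"
      "\<forall>q\<in>fst c. \<forall>X\<in>tangent_space A q. \<forall>Y\<in>tangent_space A q. ds q X Y = exp (u' q) * dzdzbar c X Y"
    using ds p unfolding eu_metric_def by blast
  define u where "u = u' p"
  define Q where "Q = hopf_coeff A f c p"
  define w where "w = exp u + (cmod Q)\<^sup>2 * exp (- u)"
  define d where "d = exp u - (cmod Q)\<^sup>2 * exp (- u)"
  define e1 where "e1 = coord_vector A c p 1"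
  define e2 where "e2 = coord_vector A c p \<i>"
  define a where "a = differential A f p e1"
  define b where "b = differential A f p e2"
  have cA: "c \<in> A" using cu(2) by (simp add: conformal_coordinate_def)
  then have c: "c \<in> charts_at A p" using cu(1) by (simp add: charts_at_def)
  have e: "e1 \<in> tangent_space A p" "e2 \<in> tangent_space A p" "e1 c = 1" "e2 c = \<i>"
    using c coord_vector_in_tangent_space by (auto simp: e1_def e2_def)
  let ?B = "(\<chi> i. if i = 0 then f p else if i = 1 then a else if i = 2 then b else n p) :: real^4^4"
  have "det ?B > 0"
    using cu(1,2) unfolding conformal_coordinate_def positively_oriented_def a_def b_def e1_def e2_def
    by blast
  then have det: "det ?B \<noteq> 0" by linarith
  have u: "(cmod Q)\<^sup>2 < exp (2 * u)"
    and I: "\<And>X Y. X \<in> tangent_space A p \<Longrightarrow> Y \<in> tangent_space A p \<Longrightarrow>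
      complex_of_real (fundI A f p X Y) = Q * dz2 c X Y + of_real (w * dzdzbar c X Y) + cnj Q * cnj (dz2 c X Y)"
    and II: "\<And>X Y. X \<in> tangent_space A p \<Longrightarrow> Y \<in> tangent_space A p \<Longrightarrow>
      fundII A f n p X Y = \<sigma> * d * dzdzbar c X Y"
    using cu(1,3) unfolding fundamental_expressions_def Let_def u_def Q_def w_def d_def by blast+
  have I': "fundI A f p X Y = 2 * Re (Q * dz2 c X Y) + w * dzdzbar c X Y"
    if "X \<in> tangent_space A p" "Y \<in> tangent_space A p" for X Y
    using arg_cong[OF I[OF that], of Re] by simp
  \<comment> \<open>On the pairs of coordinate vectors (1,1), (1,i), (i,i) the form
    \<open>dz2\<close> takes the values 1, i, -1, and \<open>dzdzbar\<close> the values 1, 0,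
    1.\<close>
  have E: "minkowski a a = w + 2 * Re Q" and F: "minkowski a b = - 2 * Im Q" and G: "minkowski b b = w - 2 * Re Q"
    using I'[OF e(1) e(1)] I'[OF e(1) e(2)] I'[OF e(2) e(2)] e(3,4)
    by (simp_all add: fundI_def dz2_def dzdzbar_def a_def b_def)
  \<comment> \<open>The squares of the sum and of the difference of e^u and |Q|^2 e^(-u) differ by
    four times their product, which is 4 |Q|^2.\<close>
  have "exp u * exp (- u) = 1" by (simp add: exp_minus)
  then have "w\<^sup>2 - 4 * (cmod Q)\<^sup>2 = d\<^sup>2"
    unfolding w_def d_def by algebra
  then have det2: "(w + 2 * Re Q) * (w - 2 * Re Q) - (- 2 * Im Q)\<^sup>2 = d\<^sup>2"
    unfolding cmod_power2 by (simp add: algebra_simps power2_eq_square)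
  have "(cmod Q)\<^sup>2 * exp (- u) < exp (2 * u) * exp (- u)" using u by simp
  then have "d > 0" by (simp add: d_def flip: exp_add)
  \<comment> \<open>Stated at all points of the surface, since the first three identities are
    differentiated below.\<close>
  have normals: "minkowski (n q) (n q) = 1" "minkowski (n q) (f q) = 0" "minkowski (f q) (f q) = -1"
    "X \<in> tangent_space A q \<Longrightarrow> minkowski (n q) (differential A f q X) = 0"
    if "q \<in> topspace M" for q X
    using hyp that by (auto simp: hyperbolic_surface_def hyperbolic_space_def)
  have fdf: "minkowski (f p) (differential A f p X) = 0" if "X \<in> tangent_space A p" for X
    using minkowski_differential_const[OF f_smooth f_smooth normals(3) p that]
    by (simp add: minkowski_commute)
  have ndn: "minkowski (n p) (differential A n p X) = 0" if "X \<in> tangent_space A p" for X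
    using minkowski_differential_const[OF n_smooth n_smooth normals(1) p that]
    by (simp add: minkowski_commute)
  have fdn: "minkowski (f p) (differential A n p X) = 0" if "X \<in> tangent_space A p" for X
    using minkowski_differential_const[OF n_smooth f_smooth normals(2) p that] normals(4)[OF p that]
    by (simp add: minkowski_commute)
  have "weak_metric A f n p X X = 2 * w * (cmod (X c))\<^sup>2" if X: "X \<in> tangent_space A p" for X
  proof -
    define x where "x = Re (X c)"
    define y where "y = Im (X c)"
    have III: "minkowski (differential A n p X) (differential A n p X)
        = \<sigma>\<^sup>2 * ((w - 2 * Re Q) * x\<^sup>2 - 2 * (- 2 * Im Q) * x * y + (w + 2 * Re Q) * y\<^sup>2)"
    proof (rule third_form_conformal[OF det _ _ _ _ E F G det2])
      show "minkowski a (differential A n p X) = - (\<sigma> * d * x)"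
        using II[OF e(1) X] e(3) by (simp add: fundII_def dzdzbar_def a_def x_def)
      show "minkowski b (differential A n p X) = - (\<sigma> * d * y)"
        using II[OF e(2) X] e(4) by (simp add: fundII_def dzdzbar_def b_def y_def)
    qed (use fdf ndn fdn normals(4)[OF p] e X \<open>d > 0\<close> in \<open>auto simp: a_def b_def\<close>)
    have "minkowski (differential A f p X) (differential A f p X)
        = (w + 2 * Re Q) * x\<^sup>2 + 2 * (- 2 * Im Q) * x * y + (w - 2 * Re Q) * y\<^sup>2"
      using I'[OF X X] by (simp add: fundI_def dz2_def dzdzbar_def x_def y_def algebra_simps power2_eq_square)
    then show ?thesis
      unfolding weak_metric_eq[OF p] III cmod_power2 using \<sigma>
      by (simp add: x_def y_def algebra_simps)
  qed
  moreover have "dzdzbar c X X = (cmod (X c))\<^sup>2" for X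
    unfolding dzdzbar_def cmod_power2 by (simp add: power2_eq_square)
  ultimately show thesis
    using that[of c Q u] c u II cu(1,4) by (simp add: w_def d_def u_def)
qed

text \<open>The terms |Q|^2 e^(-u) of the two forms cancel, which leaves an expression in f and n
  alone.\<close>

lemma ds_eq:
  assumes p: "p \<in> topspace M" and X: "X \<in> tangent_space A p"
  shows "ds p X X = weak_metric A f n p X X / 4 + fundII A f n p X X / (2 * \<sigma>)"
proof -
  obtain c u Q where "weak_metric A f n p X X = 2 * (exp u + (cmod Q)\<^sup>2 * exp (- u)) * (cmod (X c))\<^sup>2"
    "fundII A f n p X X = \<sigma> * (exp u - (cmod Q)\<^sup>2 * exp (- u)) * (cmod (X c))\<^sup>2"
    "ds p X X = exp u * (cmod (X c))\<^sup>2"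
    using forms_conformal[OF p] X by metis
  then show ?thesis using \<sigma> by (simp add: field_simps)
qed

lemma weak_metric_bounds:
  assumes p: "p \<in> topspace M" and X: "X \<in> tangent_space A p"
  shows "2 * ds p X X \<le> weak_metric A f n p X X" "weak_metric A f n p X X \<le> 4 * ds p X X"
proof -
  obtain c u Q where u: "(cmod Q)\<^sup>2 < exp (2 * u)"
    and eqs: "weak_metric A f n p X X = 2 * (exp u + (cmod Q)\<^sup>2 * exp (- u)) * (cmod (X c))\<^sup>2"
    "ds p X X = exp u * (cmod (X c))\<^sup>2"
    using forms_conformal[OF p] X by metis
  have "(cmod Q)\<^sup>2 * exp (- u) < exp (2 * u) * exp (- u)" using u by simp
  then have "(cmod Q)\<^sup>2 * exp (- u) \<le> exp u" by (simp flip: exp_add)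
  then have "(cmod Q)\<^sup>2 * exp (- u) * (cmod (X c))\<^sup>2 \<le> exp u * (cmod (X c))\<^sup>2"
    by (rule mult_right_mono) simp
  moreover have "(cmod Q)\<^sup>2 * exp (- u) * (cmod (X c))\<^sup>2 \<ge> 0" by simp
  ultimately show "2 * ds p X X \<le> weak_metric A f n p X X" "weak_metric A f n p X X \<le> 4 * ds p X X"
    unfolding eqs by (simp_all add: algebra_simps)
qed

lemma ds_pos:
  assumes p: "p \<in> topspace M" and X: "X \<in> tangent_space A p" "X \<noteq> (\<lambda>_. 0)"
  shows "ds p X X > 0"
proof -
  obtain c u where "c \<in> charts_at A p" "ds p X X = exp u * (cmod (X c))\<^sup>2"
    using forms_conformal[OF p] X by metis
  moreover have "X c \<noteq> 0" using tangent_eq_zero[OF X(1) calculation(1)] X(2) by blast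
  ultimately show ?thesis by simp
qed

lemma continuous_metric_weak_metric: "continuous_metric A (weak_metric A f n)"
proof (rule continuous_metricI[OF f_smooth n_smooth, where r = 1 and s = "1 / \<sigma>\<^sup>2" and t = 0])
  fix p X assume *: "p \<in> topspace M" "X \<in> tangent_space A p"
  show "X \<noteq> (\<lambda>_. 0) \<Longrightarrow> weak_metric A f n p X X > 0"
    using weak_metric_bounds(1)[OF *] ds_pos[OF *] by simp
qed (simp add: weak_metric_eq)

lemma continuous_metric_ds: "continuous_metric A ds"
\<comment> \<open>The first two coefficients are those of a quarter of the weak metric; the third
  comes from II/(2\<sigma>), with the sign in II = -<df, dn>.\<close>
proof (rule continuous_metricI[OF f_smooth n_smooth, where r = "1/4" and s = "1 / (4 * \<sigma>\<^sup>2)" and t = "- 1 / (2 * \<sigma>)"])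
  fix p X assume *: "p \<in> topspace M" "X \<in> tangent_space A p"
  show "ds p X X = 1/4 * minkowski (differential A f p X) (differential A f p X)
        + 1 / (4 * \<sigma>\<^sup>2) * minkowski (differential A n p X) (differential A n p X)
        + - 1 / (2 * \<sigma>) * minkowski (differential A f p X) (differential A n p X)"
    unfolding ds_eq[OF *] weak_metric_eq[OF *(1)] fundII_def using \<sigma> by (simp add: field_simps)
qed (rule ds_pos)

theorem weakly_complete_iff: "weakly_complete M A f n \<longleftrightarrow> complete_metric M A ds"
  unfolding weakly_complete_def
\<comment> \<open>The constants refer to lengths: 2 is the square root of 4, and 1 is enough in the
  other direction because ds^2 is at most half the weak metric.\<close>
proof (rule complete_metric_bilipschitz[OF _ continuous_metric_weak_metric continuous_metric_ds, of 2 1])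
  show "connected_space M" using hyp by (simp add: hyperbolic_surface_def)
  fix p X assume *: "p \<in> topspace M" "X \<in> tangent_space A p"
  show "weak_metric A f n p X X \<le> 2\<^sup>2 * ds p X X" using weak_metric_bounds(2)[OF *] by simp
  \<comment> \<open>From 2 ds^2 \<le> dt^2 \<le> 4 ds^2, without a case distinction on whether
    \<open>X\<close> vanishes.\<close>
  have "0 \<le> ds p X X" using weak_metric_bounds[OF *] by linarith
  then show "ds p X X \<le> 1\<^sup>2 * weak_metric A f n p X X" using weak_metric_bounds(1)[OF *] by simp
qed auto

end

theorem lemma3p1:
  fixes M :: "'a topology" and A :: "'a chart set"
    and f n :: "'a \<Rightarrow> real^4" and K \<sigma> :: real and ds :: "'a form"
  assumes "hyperbolic_surface M A f n"
    and "\<forall>p\<in>topspace M. gauss_curvature A f n p = K"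
    and "K > -1"
    and "positive_definite_on M A (fundII A f n)"
    and "\<sigma> > 0" and "K = -1 + \<sigma>\<^sup>2"
    and "eu_metric M A f n \<sigma> ds"
  shows "weakly_complete M A f n \<longleftrightarrow> complete_metric M A ds"
proof -
  interpret conformal_hyperbolic_surface M A f n \<sigma> ds
    using assms by unfold_locales auto
  show ?thesis by (rule weakly_complete_iff)
qed

end
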